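(* Let $w\in L^1(\mathbb{R}^d)\cap L^\infty(\mathbb{R}^d)$, $w\neq0$, satisfy (A): for any $a>0$ there exists $c_a>0$ such that $w(\xi)\le c_ae^{-a|\xi|}$ for almost all $\xi\in\mathbb{R}^d$. Assume there exist measurable functions $Q_1,\dots,Q_d:[0,\infty)\to\mathbb{R}$ such that $$w(\xi_1,\dots,\xi_d)=\prod_{i=1}^de^{-Q_i(|\xi_i|)},$$ and that $|Q_i-Q_j|$ is bounded for all $i,j\in\{1,\dots,d\}$. Assume further that for each $i=1,\dots,d$ there exists $c_i$ such that $Q_i(t)+c_it$ is non-decreasing for sufficiently large $t\ge0$, and that $Q_i(t+R_i)-Q_i(t)\to\infty$ as $t\to\infty$ for some $R_i>0$. Then $w$ satisfies (A) and also: (B) there exists $B>0$ such that for any $y\in\mathbb{R}^d$, $\limsup_{n\to\infty}\mathcal{E}_n^-(y;w)<B$ and $\limsup_{n\to\infty}\mathcal{E}_n^+(y;w)<B$; (C) $\mathcal{G}(w)$ spans ${\rm M}_d(\mathbb{R})$ as a real vector space.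
   Context: $L^2(w)$ is the $L^2$-space for the measure $w(\xi)\,d\xi$. $P_n\subset\mathbb{C}[\xi_1,\dots,\xi_d]$ is the space of polynomials of total degree at most $n$, regarded as a subspace of $L^2(w)$. For $y\in\mathbb{R}^d$, $(m_yh)(\xi)=e^{y^\top\xi}h(\xi)$. Define $$\mathcal{E}_n^+(y;w)=\Big(\sup_{P\in P_n\setminus\{0\}}\frac{\|m_yP\|_{L^2(w)}}{\|P\|_{L^2(w)}}\Big)^{1/n},\qquad \mathcal{E}_n^-(y;w)=\Big(\sup_{P\in P_n\setminus\{0\}}\frac{\|P\|_{L^2(w)}}{\|m_yP\|_{L^2(w)}}\Big)^{1/n}.$$ $\mathcal{G}(w)$ is the set of $A\in{\rm GL}_d(\mathbb{R})$ such that for some $\lambda>0$, $w(A^\top\xi)\ge\lambda w(\xi)$ for almost every $\xi\in\mathbb{R}^d$. *)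

theory Defs
  imports "HOL-Analysis.Analysis"
begin

definition ennreal_root :: "nat \<Rightarrow> ennreal \<Rightarrow> ennreal" where
  "ennreal_root n x = (if x = top then top else ennreal (root n (enn2real x)))"

text \<open>
  The norm takes the value \<open>top\<close> outside the space \<open>L\<^sup>2(w)\<close>, so that no
  suprema or quotients below depend on default values of the Bochner integral.
  Lebesgue (rather than Borel) measurability is used throughout, which is the weaker requirement.
\<close>

definition weight_measure :: "(real ^ 'd \<Rightarrow> real) \<Rightarrow> (real ^ 'd) measure" where
  "weight_measure w = density lebesgue (\<lambda>\<xi>. ennreal (w \<xi>))"

definition L2_norm :: "(real ^ 'd \<Rightarrow> real) \<Rightarrow> (real ^ 'd \<Rightarrow> complex) \<Rightarrow> ennreal" where
  "L2_norm w f = ennreal_root 2 (\<integral>\<^sup>+ \<xi>. ennreal ((cmod (f \<xi>))\<^sup>2) \<partial>weight_measure w)"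

text \<open>
  Polynomials are represented by their functions on \<open>real ^ 'd\<close>, which determine the coefficients.
  A multi-index is a function \<open>'d \<Rightarrow> nat\<close>; as \<open>'d\<close> is finite, the index set of the sum is finite.
\<close>

definition poly_space :: "nat \<Rightarrow> (real ^ 'd \<Rightarrow> complex) set" where
  "poly_space n =
    {P. \<exists>c :: ('d \<Rightarrow> nat) \<Rightarrow> complex.
       P = (\<lambda>\<xi>. \<Sum>\<alpha> | (\<Sum>i\<in>UNIV. \<alpha> i) \<le> n. c \<alpha> * (\<Prod>i\<in>UNIV. complex_of_real (\<xi> $ i) ^ \<alpha> i))}"

definition mult_exp :: "real ^ 'd \<Rightarrow> (real ^ 'd \<Rightarrow> complex) \<Rightarrow> real ^ 'd \<Rightarrow> complex" where
  "mult_exp y h = (\<lambda>\<xi>. complex_of_real (exp (y \<bullet> \<xi>)) * h \<xi>)"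

definition E_plus :: "nat \<Rightarrow> real ^ 'd \<Rightarrow> (real ^ 'd \<Rightarrow> real) \<Rightarrow> ennreal" where
  "E_plus n y w =
    ennreal_root n (SUP P \<in> poly_space n - {\<lambda>_. 0}. L2_norm w (mult_exp y P) / L2_norm w P)"

definition E_minus :: "nat \<Rightarrow> real ^ 'd \<Rightarrow> (real ^ 'd \<Rightarrow> real) \<Rightarrow> ennreal" where
  "E_minus n y w =
    ennreal_root n (SUP P \<in> poly_space n - {\<lambda>_. 0}. L2_norm w P / L2_norm w (mult_exp y P))"

definition weight_matrices :: "(real ^ 'd \<Rightarrow> real) \<Rightarrow> (real ^ 'd ^ 'd) set" where
  "weight_matrices w =
    {A. invertible A \<and> (\<exists>l>0. AE \<xi> in lebesgue. w (transpose A *v \<xi>) \<ge> l * w \<xi>)}"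

definition condition_A :: "(real ^ 'd \<Rightarrow> real) \<Rightarrow> bool" where
  "condition_A w \<longleftrightarrow> (\<forall>a>0. \<exists>c>0. AE \<xi> in lebesgue. w \<xi> \<le> c * exp (- a * norm \<xi>))"

definition condition_B :: "(real ^ 'd \<Rightarrow> real) \<Rightarrow> bool" where
  "condition_B w \<longleftrightarrow>
    (\<exists>B::real. B > 0 \<and>
      (\<forall>y. limsup (\<lambda>n. E_minus n y w) < ennreal B \<and> limsup (\<lambda>n. E_plus n y w) < ennreal B))"

definition condition_C :: "(real ^ 'd \<Rightarrow> real) \<Rightarrow> bool" where
  "condition_C w \<longleftrightarrow> span (weight_matrices w) = UNIV"

end

theory Submission
  imports Defs "HOL-Real_Asymp.Real_Asymp"
begin

text \<open>
  Part (C) is linear algebra. Since the \<open>Q\<^sub>i\<close> differ by bounded amounts, permuting coordinates and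
  flipping their signs changes \<open>w\<close> by at most a constant factor, so all signed permutation matrices
  lie in \<open>weight_matrices w\<close>. Two of them that differ in a single sign have a multiple of a matrix
  unit as their difference, so they span.

  Part (B) compares \<open>\<integral> e\<^bsup>a\<bullet>\<xi>\<^esup> \<bar>P\<bar>\<^sup>2 w\<close> with \<open>\<integral> e\<^bsup>b\<bullet>\<xi>\<^esup> \<bar>P\<bar>\<^sup>2 w\<close> for fixed \<open>a\<close>, \<open>b\<close>, up to a factor
  \<open>D\<^sup>n\<close> with \<open>D\<close> depending only on \<open>d\<close>, and for \<open>n\<close> large. Taking \<open>(a, b)\<close> to be \<open>(2y, 0)\<close> or \<open>(0, 2y)\<close> bounds both
  growth rates. As \<open>w\<close> is a product, the exponents can be exchanged one coordinate at a time
  (\<open>change_exponent\<close>), on each line parallel to a coordinate axis, which leaves a statement about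
  polynomials \<open>p\<close> of degree at most \<open>n\<close> in one variable (\<open>one_variable_comparison\<close>).

  In one variable the mass of \<open>\<bar>p\<bar>\<^sup>2 e\<^bsup>-Q\<^esup>\<close> sits, up to a factor \<open>C\<^sup>n\<close>, in an interval \<open>[-r, r]\<close> with
  \<open>r\<close> as small a multiple of \<open>n\<close> as desired, and on that interval \<open>e\<^bsup>at\<^esup>\<close> and \<open>e\<^bsup>bt\<^esup>\<close> have a ratio of at
  most \<open>e\<^sup>n\<close>. The right \<open>r\<close> is a near maximiser of \<open>t\<^bsup>2n+2\<^esup> e\<^bsup>-Q(t)+\<Lambda>t\<^esup>\<close>. That \<open>r \<le> \<epsilon> n\<close> follows from the
  growth hypothesis: beyond \<open>\<epsilon> n\<close>, a step of length \<open>R\<close> multiplies \<open>t\<^bsup>2n+2\<^esup>\<close> by a bounded factor and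
  \<open>e\<^bsup>-Q\<^esup>\<close> by an arbitrarily small one (\<open>near_maximizer\<close>). Beyond \<open>r\<close> the weight is then at most
  \<open>2 (r/t)\<^bsup>2n+2\<^esup> e\<^bsup>-Q(r)+\<Lambda>r\<^esup>\<close>, while interpolation at nodes in \<open>[r/2, r]\<close> bounds \<open>\<bar>p(t)\<bar>\<^sup>2\<close> by
  \<open>C\<^sup>n (t/r)\<^bsup>2n\<^esup>\<close> times the mean of \<open>\<bar>p\<bar>\<^sup>2\<close> there (\<open>norm_poly_square_le_integral\<close>). The powers
  of \<open>t\<close> cancel down to the integrable \<open>t\<^bsup>-2\<^esup>\<close>, and near-monotonicity of \<open>Q\<close> makes the weight on
  \<open>[r/2, r]\<close> at least \<open>e\<^bsup>-Q(r)-cr\<^esup>\<close>, so that the tail is controlled by the mass on \<open>[r/2, r]\<close>: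
  what remains are exponentials in \<open>r\<close>, and these are at most \<open>e\<^sup>n\<close>.
\<close>

section \<open>Growth of a polynomial outside an interval\<close>

text \<open>
  Both sides are polynomials in \<open>t\<close> of degree below \<open>card I\<close> that agree at the \<open>card I\<close> distinct
  nodes.
\<close>

lemma lagrange_interpolation:
  fixes p :: "'a::field poly" and x :: "'i \<Rightarrow> 'a"
  assumes fin: "finite I" and inj: "inj_on x I" and deg: "degree p < card I"
  shows "poly p t = (\<Sum>k\<in>I. poly p (x k) * (\<Prod>j\<in>I - {k}. (t - x j) / (x k - x j)))"
proof -
  define l where "l k = (\<Prod>j\<in>I - {k}. smult (1 / (x k - x j)) [:- x j, 1:])" for k
  have poly_l: "poly (l k) s = (\<Prod>j\<in>I - {k}. (s - x j) / (x k - x j))" for k s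
    unfolding l_def poly_prod by (intro prod.cong) (auto simp: algebra_simps diff_divide_distrib)
  have l_at_node: "poly (l k) (x m) = (if k = m then 1 else 0)" if "k \<in> I" "m \<in> I" for k m
  proof (cases "k = m")
    case True
    have "(x k - x j) / (x k - x j) = 1" if "j \<in> I - {k}" for j
      using that \<open>k \<in> I\<close> inj by (auto dest: inj_onD)
    then show ?thesis unfolding poly_l using True by simp
  next
    case False
    then show ?thesis unfolding poly_l using that fin by (auto intro!: bexI[of _ m])
  qed
  have deg_l: "degree (l k) < card I" if "k \<in> I" for k
  proof -
    have "degree (l k) \<le> (\<Sum>j\<in>I - {k}. degree (smult (1 / (x k - x j)) [:- x j, 1:]))"
      unfolding l_def using degree_prod_sum_le[OF finite_Diff[OF fin]] by (metis (lifting) comp_apply sum.cong)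
    also have "\<dots> \<le> (\<Sum>j\<in>I - {k}. 1)"
      by (intro sum_mono) (auto intro: order_trans[OF degree_smult_le])
    also have "\<dots> < card I" using fin that by (auto simp: card_gt_0_iff intro!: diff_less)
    finally show ?thesis .
  qed
  define q where "q = (\<Sum>k\<in>I. smult (poly p (x k)) (l k))"
  have "degree q < card I"
    unfolding q_def using deg deg_l
    by (intro degree_sum_less) (auto intro: le_less_trans[OF degree_smult_le])
  moreover have "poly q (x m) = poly p (x m)" if "m \<in> I" for m
  proof -
    have "poly q (x m) = (\<Sum>k\<in>I. if k = m then poly p (x k) else 0)"
      unfolding q_def poly_sum using l_at_node that by (intro sum.cong) auto
    also have "\<dots> = poly p (x m)" using that fin by simp
    finally show ?thesis .
  qed
  ultimately have "q = p"
    using deg by (intro poly_eqI_degree[where A = "x ` I"]) (auto simp: card_image[OF inj])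
  then have "poly p t = poly q t" by simp
  also have "\<dots> = (\<Sum>k\<in>I. poly p (x k) * (\<Prod>j\<in>I - {k}. (t - x j) / (x k - x j)))"
    unfolding q_def poly_sum by (simp add: poly_l)
  finally show ?thesis .
qed

lemma prod_distances_to_index:
  assumes "k \<le> n"
  shows "(\<Prod>j\<in>{..n} - {k}. \<bar>real k - real j\<bar>) = fact k * fact (n - k)"
proof -
  have split: "{..n} - {k} = {..<k} \<union> {k<..n}" using assms by auto
  have "(\<Prod>j\<in>{..n} - {k}. \<bar>real k - real j\<bar>)
      = (\<Prod>j\<in>{..<k}. \<bar>real k - real j\<bar>) * (\<Prod>j\<in>{k<..n}. \<bar>real k - real j\<bar>)"
    unfolding split by (rule prod.union_disjoint) auto
  also have "(\<Prod>j\<in>{..<k}. \<bar>real k - real j\<bar>) = (\<Prod>i\<in>{1..k}. real i)"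
    by (rule prod.reindex_bij_witness[of _ "\<lambda>i. k - i" "\<lambda>j. k - j"]) auto
  also have "\<dots> = fact k" by (simp add: fact_prod)
  also have "(\<Prod>j\<in>{k<..n}. \<bar>real k - real j\<bar>) = (\<Prod>i\<in>{1..n - k}. real i)"
    by (rule prod.reindex_bij_witness[of _ "\<lambda>i. k + i" "\<lambda>j. j - k"]) auto
  also have "\<dots> = fact (n - k)" by (simp add: fact_prod)
  finally show ?thesis .
qed

text \<open>
  For the nodes \<open>s + k h\<close> the denominators of the Lagrange basis are \<open>h\<^sup>n k! (n - k)!\<close>, which gives
  the binomial coefficients.
\<close>

lemma norm_poly_le_equispaced:
  fixes p :: "complex poly" and t s h L :: real
  assumes deg: "degree p \<le> n" and h: "h > 0"
    and L: "\<And>j. j \<le> n \<Longrightarrow> \<bar>t - (s + real j * h)\<bar> \<le> L"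
  shows "cmod (poly p (of_real t))
    \<le> (L / h) ^ n / fact n * (\<Sum>k\<le>n. real (n choose k) * cmod (poly p (of_real (s + real k * h))))"
proof -
  define x where "x k = complex_of_real (s + real k * h)" for k :: nat
  have "inj_on x {..n}" using h by (auto simp: inj_on_def x_def)
  then have "poly p (of_real t)
      = (\<Sum>k\<le>n. poly p (x k) * (\<Prod>j\<in>{..n} - {k}. (of_real t - x j) / (x k - x j)))"
    using deg by (intro lagrange_interpolation) auto
  then have "cmod (poly p (of_real t))
      \<le> (\<Sum>k\<le>n. cmod (poly p (x k)) * (\<Prod>j\<in>{..n} - {k}. cmod (of_real t - x j) / cmod (x k - x j)))"
    by (simp add: sum_norm_le norm_mult prod_norm[symmetric] norm_divide)
  also have "\<dots> \<le> (\<Sum>k\<le>n. cmod (poly p (x k)) * ((L / h) ^ n / fact n * real (n choose k)))"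
  proof (intro sum_mono mult_left_mono)
    fix k assume "k \<in> {..n}"
    then have k: "k \<le> n" by simp
    have dist_x: "cmod (x k - x j) = h * \<bar>real k - real j\<bar>" for j
    proof -
      have "x k - x j = complex_of_real (h * (real k - real j))"
        by (simp add: x_def algebra_simps)
      then show ?thesis using h by (simp only: norm_of_real abs_mult abs_of_pos)
    qed
    have dist_t: "cmod (of_real t - x j) \<le> L" if "j \<le> n" for j
    proof -
      have "of_real t - x j = complex_of_real (t - (s + real j * h))" by (simp add: x_def)
      then show ?thesis using L[OF that] by (simp only: norm_of_real)
    qed
    have "(\<Prod>j\<in>{..n} - {k}. cmod (of_real t - x j) / cmod (x k - x j))
        \<le> (\<Prod>j\<in>{..n} - {k}. (L / h) / \<bar>real k - real j\<bar>)"
      using h dist_t by (intro prod_mono) (auto simp: dist_x intro!: divide_right_mono)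
    also have "\<dots> = (L / h) ^ n / (fact k * fact (n - k))"
      unfolding prod_dividef prod_distances_to_index[OF k] using k by (simp add: power_divide)
    also have "\<dots> = (L / h) ^ n / fact n * real (n choose k)"
      by (simp add: binomial_fact[OF k])
    finally show "(\<Prod>j\<in>{..n} - {k}. cmod (of_real t - x j) / cmod (x k - x j))
        \<le> (L / h) ^ n / fact n * real (n choose k)" .
  qed auto
  also have "\<dots> = (L / h) ^ n / fact n * (\<Sum>k\<le>n. real (n choose k) * cmod (poly p (x k)))"
    by (simp add: sum_distrib_left mult_ac)
  finally show ?thesis by (simp add: x_def)
qed

lemma sum_binomial_squares_le: "(\<Sum>k\<le>n. (real (n choose k))\<^sup>2) \<le> 4 ^ n"
proof -
  have "(\<Sum>k\<le>n. (real (n choose k))\<^sup>2) = real (2 * n choose n)"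
    by (simp flip: choose_square_sum)
  also have "\<dots> \<le> real (2 ^ (2 * n))" by (intro of_nat_mono binomial_le_pow2)
  finally show ?thesis by (simp add: power_mult)
qed

lemma power_le_exp_fact: "real (n + 1) ^ n / fact n \<le> exp 2 ^ n" if "n \<ge> 1"
proof -
  have "real (n + 1) ^ n / fact n \<le> exp (real (n + 1))"
    using sum_le_suminf[OF summable_exp_generic, of "{n}" "real (n + 1)"]
    by (simp add: exp_def divide_inverse mult.commute)
  also have "\<dots> \<le> exp 2 ^ n" using that by (simp flip: exp_of_nat_mult)
  finally show ?thesis .
qed

text \<open>
  The \<open>n + 1\<close> nodes have spacing \<open>r / (2(n + 1))\<close> and stay inside \<open>[r/2, r]\<close> for every admissible
  starting point \<open>s\<close>, which leaves \<open>s\<close> free to be averaged over one spacing. The constant is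
  \<open>4\<^sup>2\<close> from the distances \<open>\<bar>t - x\<^sub>j\<bar> \<le> 2\<bar>t\<bar>\<close> and the spacing, \<open>(e\<^sup>2)\<^sup>2\<close> from
  \<open>(n + 1)\<^sup>n / n! \<le> e\<^bsup>n+1\<^esup>\<close>, and \<open>4\<close> from the squares of the binomial coefficients.
\<close>

lemma norm_poly_square_le_sum_equispaced:
  fixes p :: "complex poly" and t r s :: real
  assumes n: "n \<ge> 1" and deg: "degree p \<le> n" and r: "0 < r" "r \<le> \<bar>t\<bar>"
    and s: "r / 2 \<le> s" "s \<le> r / 2 + r / (2 * real (n + 1))"
  shows "(cmod (poly p (of_real t)))\<^sup>2 \<le> (64 * exp 4) ^ n * (\<bar>t\<bar> / r) ^ (2 * n)
      * (\<Sum>k\<le>n. (cmod (poly p (of_real (s + real k * (r / (2 * real (n + 1)))))))\<^sup>2)"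
proof -
  define h where "h = r / (2 * real (n + 1))"
  define a where "a k = cmod (poly p (of_real (s + real k * h)))" for k :: nat
  have h: "h > 0" using r by (simp add: h_def)
  have "\<bar>t - (s + real j * h)\<bar> \<le> 2 * \<bar>t\<bar>" if "j \<le> n" for j
  proof -
    have "s + real j * h \<le> (r / 2 + h) + real n * h"
      using s(2) that h unfolding h_def[symmetric] by (intro add_mono mult_right_mono) auto
    also have "\<dots> = r"
    proof -
      have "m * (r / (2 * m)) = r / 2" if "m > 0" for m :: real using that by simp
      from this[of "real (n + 1)"] have "real (n + 1) * h = r / 2" by (simp add: h_def)
      moreover have "r / 2 + h + real n * h = r / 2 + real (n + 1) * h" by (simp add: algebra_simps)
      ultimately show ?thesis by simp
    qed
    finally have "s + real j * h \<le> r" .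
    moreover have "real j * h \<ge> 0" using h by simp
    ultimately show ?thesis using r s(1) by linarith
  qed
  then have "cmod (poly p (of_real t)) \<le> (2 * \<bar>t\<bar> / h) ^ n / fact n * (\<Sum>k\<le>n. real (n choose k) * a k)"
    unfolding a_def by (intro norm_poly_le_equispaced deg h)
  also have "(2 * \<bar>t\<bar> / h) ^ n / fact n = (4 * (\<bar>t\<bar> / r)) ^ n * (real (n + 1) ^ n / fact n)"
    by (simp add: h_def power_mult_distrib[symmetric] mult_ac)
  also have "\<dots> * (\<Sum>k\<le>n. real (n choose k) * a k)
      \<le> ((4 * (\<bar>t\<bar> / r)) ^ n * exp 2 ^ n) * (\<Sum>k\<le>n. real (n choose k) * a k)"
    using power_le_exp_fact[OF n] r
    by (intro mult_right_mono mult_left_mono sum_nonneg) (auto simp: a_def)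
  finally have "(cmod (poly p (of_real t)))\<^sup>2
      \<le> (((4 * (\<bar>t\<bar> / r)) ^ n * exp 2 ^ n) * (\<Sum>k\<le>n. real (n choose k) * a k))\<^sup>2"
    by (intro power_mono) auto
  also have "\<dots> = (16 * exp 4) ^ n * (\<bar>t\<bar> / r) ^ (2 * n) * (\<Sum>k\<le>n. real (n choose k) * a k)\<^sup>2"
  proof -
    have "(exp 2 ^ n)\<^sup>2 = (exp 4 :: real) ^ n"
      by (simp add: power_mult[symmetric] mult.commute[of n] power_mult flip: exp_of_nat_mult)
    moreover have "((4::real) ^ n)\<^sup>2 = 16 ^ n" by (simp add: power2_eq_square flip: power_mult_distrib)
    ultimately show ?thesis by (simp only: power_mult_distrib power_even_eq) (simp only: mult_ac)
  qed
  also have "\<dots> \<le> (16 * exp 4) ^ n * (\<bar>t\<bar> / r) ^ (2 * n) * (4 ^ n * (\<Sum>k\<le>n. (a k)\<^sup>2))"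
  proof (intro mult_left_mono)
    have "(\<Sum>k\<le>n. real (n choose k) * a k)\<^sup>2 \<le> (\<Sum>k\<le>n. (real (n choose k))\<^sup>2) * (\<Sum>k\<le>n. (a k)\<^sup>2)"
      by (rule Cauchy_Schwarz_ineq_sum)
    also have "\<dots> \<le> 4 ^ n * (\<Sum>k\<le>n. (a k)\<^sup>2)"
      by (intro mult_right_mono sum_binomial_squares_le sum_nonneg) auto
    finally show "(\<Sum>k\<le>n. real (n choose k) * a k)\<^sup>2 \<le> 4 ^ n * (\<Sum>k\<le>n. (a k)\<^sup>2)" .
  qed (use r in auto)
  also have "\<dots> = (64 * exp 4) ^ n * (\<bar>t\<bar> / r) ^ (2 * n) * (\<Sum>k\<le>n. (a k)\<^sup>2)"
  proof -
    have "(16::real) ^ n * 4 ^ n = 64 ^ n" by (simp flip: power_mult_distrib)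
    then show ?thesis by (simp add: power_mult_distrib mult_ac)
  qed
  finally show ?thesis by (simp add: a_def h_def)
qed

lemma sum_indicator_adjacent_intervals:
  fixes a h :: real
  assumes "h \<ge> 0"
  shows "(\<Sum>k\<le>n. indicator {a + real k * h..<a + real (Suc k) * h} s) =
    (indicator {a..<a + real (Suc n) * h} s :: ennreal)"
proof (induction n)
  case 0 then show ?case by simp
next
  case (Suc n)
  have "a \<le> a + real (Suc n) * h" "a + real (Suc n) * h \<le> a + real (Suc (Suc n)) * h"
    using assms by (auto intro!: mult_right_mono)
  then show ?case unfolding sum.atMost_Suc Suc by (auto simp: indicator_def)
qed

text \<open>
  Averaging the interpolation bound over the starting point turns the sum over the nodes into
  the integral over \<open>[r/2, r]\<close>, because the translates of one spacing tile that interval.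
\<close>

lemma norm_poly_square_le_integral:
  fixes p :: "complex poly" and t r :: real
  assumes n: "n \<ge> 1" and deg: "degree p \<le> n" and r: "0 < r" "r \<le> \<bar>t\<bar>"
  shows "ennreal ((cmod (poly p (of_real t)))\<^sup>2) \<le>
    ennreal ((64 * exp 4) ^ n * (\<bar>t\<bar> / r) ^ (2 * n) * (2 * real (n + 1) / r))
      * (\<integral>\<^sup>+ s. ennreal ((cmod (poly p (of_real s)))\<^sup>2) * indicator {r / 2..r} s \<partial>lborel)"
proof -
  define h where "h = r / (2 * real (n + 1))"
  define A where "A = (64 * exp 4) ^ n * (\<bar>t\<bar> / r) ^ (2 * n)"
  define f where "f s = ennreal ((cmod (poly p (of_real s)))\<^sup>2)" for s :: real
  have h: "h > 0" using r by (simp add: h_def)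
  have A: "A \<ge> 0" using r by (simp add: A_def)
  have [measurable]: "f \<in> borel_measurable borel"
    unfolding f_def by (intro borel_measurable_continuous_onI measurable_compose[OF _ measurable_ennreal] continuous_intros)
  let ?I = "\<lambda>k. {r / 2 + real k * h..<r / 2 + real (Suc k) * h}"
  have "ennreal h * f t = (\<integral>\<^sup>+ s. f t * indicator (?I 0) s \<partial>lborel)"
    using h by (simp add: nn_integral_cmult mult.commute)
  also have "\<dots> \<le> (\<integral>\<^sup>+ s. ennreal A * (\<Sum>k\<le>n. f (real k * h + 1 * s) * indicator (?I 0) s) \<partial>lborel)"
  proof (intro nn_integral_mono)
    fix s :: real
    show "f t * indicator (?I 0) s
      \<le> ennreal A * (\<Sum>k\<le>n. f (real k * h + 1 * s) * indicator (?I 0) s)"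
    proof (cases "s \<in> ?I 0")
      case True
      then have "f t \<le> ennreal (A * (\<Sum>k\<le>n. (cmod (poly p (of_real (s + real k * h))))\<^sup>2))"
        unfolding f_def A_def h_def
        by (intro ennreal_leI norm_poly_square_le_sum_equispaced n deg r) auto
      then show ?thesis
        using True A by (simp add: f_def ennreal_mult sum_nonneg sum_ennreal add.commute)
    qed simp
  qed
  also have "\<dots> = ennreal A * (\<Sum>k\<le>n. \<integral>\<^sup>+ s. f (real k * h + 1 * s) * indicator (?I 0) s \<partial>lborel)"
    by (subst nn_integral_cmult, measurable, subst nn_integral_sum, measurable)
  also have "\<dots> = ennreal A * (\<Sum>k\<le>n. \<integral>\<^sup>+ s. f s * indicator (?I k) s \<partial>lborel)"
  proof (intro arg_cong[where f = "(*) (ennreal A)"] sum.cong refl)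
    fix k
    have "(\<integral>\<^sup>+ s. f s * indicator (?I k) s \<partial>lborel)
      = ennreal \<bar>1\<bar> * (\<integral>\<^sup>+ s. f (real k * h + 1 * s) * indicator (?I k) (real k * h + 1 * s) \<partial>lborel)"
      by (rule nn_integral_real_affine) auto
    also have "\<dots> = (\<integral>\<^sup>+ s. f (real k * h + 1 * s) * indicator (?I 0) s \<partial>lborel)"
      by (auto simp: indicator_def algebra_simps intro!: nn_integral_cong)
    finally show "(\<integral>\<^sup>+ s. f (real k * h + 1 * s) * indicator (?I 0) s \<partial>lborel)
      = (\<integral>\<^sup>+ s. f s * indicator (?I k) s \<partial>lborel)" ..
  qed
  also have "\<dots> = ennreal A * (\<integral>\<^sup>+ s. f s * (\<Sum>k\<le>n. indicator (?I k) s) \<partial>lborel)"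
    unfolding sum_distrib_left[of "f _"] by (subst nn_integral_sum) auto
  also have "\<dots> = ennreal A * (\<integral>\<^sup>+ s. f s * indicator {r / 2..<r} s \<partial>lborel)"
  proof -
    have "r / 2 + real (Suc n) * h = r" by (simp add: h_def field_simps)
    then show ?thesis using h by (simp only: sum_indicator_adjacent_intervals[OF less_imp_le])
  qed
  also have "\<dots> \<le> ennreal A * (\<integral>\<^sup>+ s. f s * indicator {r / 2..r} s \<partial>lborel)"
    by (intro mult_left_mono nn_integral_mono) (auto simp: indicator_def)
  finally have "ennreal h * f t \<le> ennreal A * (\<integral>\<^sup>+ s. f s * indicator {r / 2..r} s \<partial>lborel)" .
  then have "ennreal (1 / h) * (ennreal h * f t)
      \<le> ennreal (1 / h) * (ennreal A * (\<integral>\<^sup>+ s. f s * indicator {r / 2..r} s \<partial>lborel))"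
    by (intro mult_left_mono) auto
  also have "\<dots> = ennreal (1 / h * A) * (\<integral>\<^sup>+ s. f s * indicator {r / 2..r} s \<partial>lborel)"
    using h A by (subst ennreal_mult) (auto simp: mult.assoc)
  also have "1 / h * A = A * (2 * real (n + 1) / r)" by (simp add: h_def)
  also have "ennreal (1 / h) * (ennreal h * f t) = f t"
    using h by (simp add: mult.assoc[symmetric] flip: ennreal_mult)
  finally show ?thesis unfolding f_def A_def .
qed

section \<open>Where the mass of a weighted polynomial sits\<close>

text \<open>
  Let \<open>X = \<epsilon> n\<close>. For large \<open>n\<close> the function \<open>F(t) = t\<^bsup>2n+2\<^esup> e\<^bsup>-Q(t)+\<Lambda>t\<^esup>\<close> satisfies \<open>F(t) \<le> F(t - R)\<close> for
  \<open>t > X\<close>. Hence its values beyond \<open>X\<close> are dominated by values on \<open>[T, X]\<close>, where near-monotonicity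
  of \<open>Q\<close> bounds it. As \<open>F\<close> may be discontinuous, its supremum need not be attained, and \<open>r\<close> is only
  a point where \<open>F\<close> exceeds half of it.
\<close>

lemma near_maximizer:
  fixes Q :: "real \<Rightarrow> real" and T c \<Lambda> \<epsilon> :: real
  assumes T: "T > 0" and c: "c \<ge> 0" and mono: "mono_on {T..} (\<lambda>t. Q t + c * t)"
    and R: "R > 0" and growth: "filterlim (\<lambda>t. Q (t + R) - Q t) at_top at_top"
    and \<Lambda>: "\<Lambda> \<ge> 0" and \<epsilon>: "\<epsilon> > 0"
  shows "\<forall>\<^sub>F n in sequentially. \<exists>r. T \<le> r \<and> r \<le> \<epsilon> * real n \<and>
    (\<forall>t\<ge>r. t ^ (2 * n + 2) * exp (- Q t + \<Lambda> * t) \<le> 2 * (r ^ (2 * n + 2) * exp (- Q r + \<Lambda> * r)))"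
proof -
  \<comment> \<open>The first summand beats the growth of \<open>t\<^bsup>2n+2\<^esup>\<close> over one step, the second that of \<open>e\<^bsup>\<Lambda>t\<^esup>\<close>.\<close>
  define K where "K = 8 * R / \<epsilon> + \<Lambda> * R"
  from growth obtain T' where T': "\<And>t. t \<ge> T' \<Longrightarrow> Q (t + R) - Q t \<ge> K"
    unfolding filterlim_at_top eventually_at_top_linorder by blast
  have "\<forall>\<^sub>F n in sequentially. \<epsilon> * real n \<ge> 2 * (R + T + \<bar>T'\<bar>)"
    using \<epsilon> by real_asymp
  moreover have "\<forall>\<^sub>F n in sequentially. n \<ge> (1::nat)" by (rule eventually_ge_at_top)
  ultimately show ?thesis
  proof eventually_elim
    case (elim n)
    define N where "N = 2 * n + 2"
    define X where "X = \<epsilon> * real n"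
    define F where "F t = t ^ N * exp (- Q t + \<Lambda> * t)" for t
    have X: "X > 0" "X \<ge> 2 * R" "X - R \<ge> T" "X - R \<ge> T'" using elim T R by (auto simp: X_def)
    have step: "F t \<le> F (t - R)" if "t > X" for t
    proof -
      have pos: "t - R \<ge> X / 2" "t - R > 0" using X that by auto
      have "t / (t - R) = 1 + R / (t - R)" using pos by (simp add: field_simps)
      also have "\<dots> \<le> exp (R / (t - R))" by (rule exp_ge_add_one_self)
      also have "\<dots> \<le> exp (2 * R / X)"
      proof -
        have "R / (t - R) \<le> R / (X / 2)" using pos R X by (intro divide_left_mono) auto
        then show ?thesis by (simp add: mult.commute)
      qed
      finally have "(t / (t - R)) ^ N \<le> exp (2 * R / X) ^ N"
        using pos R by (intro power_mono) auto
      also have "\<dots> = exp (real N * (2 * R / X))" by (simp flip: exp_of_nat_mult)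
      also have "\<dots> \<le> exp (8 * R / \<epsilon>)"
      proof -
        have "real N * (2 * R / X) \<le> (4 * real n) * (2 * R / X)"
          using elim R X by (intro mult_right_mono) (auto simp: N_def)
        also have "\<dots> = 8 * R / \<epsilon>" using elim by (simp add: X_def)
        finally show ?thesis by simp
      qed
      finally have ratio: "(t / (t - R)) ^ N \<le> exp (8 * R / \<epsilon>)" .
      have "Q t - Q (t - R) \<ge> K" using T'[of "t - R"] that X by auto
      then have "- Q t + \<Lambda> * t \<le> - (8 * R / \<epsilon>) + (- Q (t - R) + \<Lambda> * (t - R))"
        by (simp add: K_def algebra_simps)
      then have "exp (- Q t + \<Lambda> * t) \<le> exp (- (8 * R / \<epsilon>)) * exp (- Q (t - R) + \<Lambda> * (t - R))"
        by (simp flip: exp_add)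
      moreover have "t ^ N \<le> exp (8 * R / \<epsilon>) * (t - R) ^ N"
        using ratio pos by (simp add: power_divide pos_divide_le_eq)
      ultimately have "F t \<le> (exp (8 * R / \<epsilon>) * (t - R) ^ N)
          * (exp (- (8 * R / \<epsilon>)) * exp (- Q (t - R) + \<Lambda> * (t - R)))"
        unfolding F_def using pos by (intro mult_mono) auto
      also have "\<dots> = F (t - R)" by (simp add: F_def exp_minus field_simps)
      finally show ?thesis .
    qed
    \<comment> \<open>Stepping down by \<open>R\<close> cannot jump over \<open>[T, X]\<close>, since \<open>X - R \<ge> T\<close>.\<close>
    have reach: "\<exists>s\<in>{T..X}. F t \<le> F s" if "T \<le> t" "t \<le> X + real k * R" for t k
      using that
    proof (induction k arbitrary: t)
      case 0
      then show ?case by auto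
    next
      case (Suc k)
      show ?case
      proof (cases "t \<le> X")
        case False
        then have "\<exists>s\<in>{T..X}. F (t - R) \<le> F s"
          using Suc.prems X by (intro Suc.IH) (auto simp: algebra_simps)
        then show ?thesis using step[of t] False by (meson not_le order_trans)
      qed (use Suc.prems in auto)
    qed
    have "F t \<le> X ^ N * exp (- Q T + c * X + \<Lambda> * X)" if "t \<in> {T..X}" for t
      unfolding F_def
    proof (intro mult_mono power_mono)
      have "Q T + c * T \<le> Q t + c * t" using that by (intro mono_onD[OF mono]) auto
      moreover have "c * t \<le> c * X" "c * T \<ge> 0" "\<Lambda> * t \<le> \<Lambda> * X"
        using that c T \<Lambda> by (auto intro: mult_left_mono)
      ultimately show "exp (- Q t + \<Lambda> * t) \<le> exp (- Q T + c * X + \<Lambda> * X)" by simp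
    qed (use that T in auto)
    then have bdd: "bdd_above (F ` {T..X})" by (rule bdd_aboveI2)
    have T_mem: "T \<in> {T..X}" using X R by auto
    have "F T > 0" using T by (simp add: F_def)
    also have "F T \<le> Sup (F ` {T..X})" using T_mem bdd by (intro cSUP_upper) auto
    finally have Sup_pos: "Sup (F ` {T..X}) > 0" .
    have "\<exists>r\<in>{T..X}. Sup (F ` {T..X}) / 2 < F r"
      using less_cSUP_iff[OF _ bdd, of "Sup (F ` {T..X}) / 2"] Sup_pos T_mem by force
    then obtain r where r: "r \<in> {T..X}" "Sup (F ` {T..X}) / 2 < F r" by blast
    have "F t \<le> 2 * F r" if "t \<ge> r" for t
    proof -
      obtain k where "(t - X) / R < real k" using reals_Archimedean2 by blast
      then have "t \<le> X + real k * R" using R by (simp add: field_simps)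
      moreover have "T \<le> t" using r that by simp
      ultimately obtain s where s: "s \<in> {T..X}" "F t \<le> F s" using reach[of t k] by blast
      have "F s \<le> Sup (F ` {T..X})" using s bdd by (intro cSUP_upper) auto
      then show ?thesis using s r by simp
    qed
    then show ?case using r by (auto simp: F_def N_def X_def)
  qed
qed

lemma nn_integral_inverse_square_tail:
  fixes r :: real
  assumes "r > 0"
  shows "(\<integral>\<^sup>+ t. ennreal ((r / \<bar>t\<bar>)\<^sup>2) * indicator {t. r \<le> \<bar>t\<bar>} t \<partial>lborel) = ennreal (2 * r)"
proof -
  define f where "f t = ennreal ((r / \<bar>t\<bar>)\<^sup>2) * indicator {r..} t" for t :: real
  have [measurable]: "f \<in> borel_measurable borel" unfolding f_def by measurable
  have "(\<integral>\<^sup>+ t. f t \<partial>lborel) = (\<integral>\<^sup>+ t. ennreal ((r / t)\<^sup>2) * indicator {r..} t \<partial>lborel)"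
    using assms by (intro nn_integral_cong) (auto simp: f_def indicator_def)
  also have "\<dots> = ennreal (0 - (- r\<^sup>2 / r))"
  proof (rule nn_integral_FTC_atLeast[where F = "\<lambda>x. - r\<^sup>2 / x"])
    fix x assume "r \<le> x"
    then show "((\<lambda>x. - r\<^sup>2 / x) has_real_derivative (r / x)\<^sup>2) (at x)"
      using assms by (auto intro!: derivative_eq_intros simp: field_simps power2_eq_square)
    show "0 \<le> (r / x)\<^sup>2" by simp
  next
    show "((\<lambda>x. - r\<^sup>2 / x) \<longlongrightarrow> 0) at_top" by real_asymp
  qed simp
  also have "\<dots> = ennreal r" using assms by (simp add: power2_eq_square)
  finally have f: "(\<integral>\<^sup>+ t. f t \<partial>lborel) = ennreal r" .
  have "(\<integral>\<^sup>+ t. ennreal ((r / \<bar>t\<bar>)\<^sup>2) * indicator {t. r \<le> \<bar>t\<bar>} t \<partial>lborel)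
      = (\<integral>\<^sup>+ t. f t + f (0 + (-1) * t) \<partial>lborel)"
    using assms by (intro nn_integral_cong) (auto simp: f_def indicator_def)
  also have "\<dots> = (\<integral>\<^sup>+ t. f t \<partial>lborel) + (\<integral>\<^sup>+ t. f (0 + (-1) * t) \<partial>lborel)"
    by (intro nn_integral_add) auto
  also have "(\<integral>\<^sup>+ t. f (0 + (-1) * t) \<partial>lborel) = (\<integral>\<^sup>+ t. f t \<partial>lborel)"
    using nn_integral_real_affine[of f "-1" 0] by simp
  finally show ?thesis using f assms by (simp flip: ennreal_plus)
qed

text \<open>
  For \<open>\<bar>t\<bar> \<ge> r\<close> the hypothesis on \<open>r\<close> bounds the weight by \<open>2 (r/\<bar>t\<bar>)\<^bsup>2n+2\<^esup> e\<^bsup>-Q(r)+\<Lambda>r\<^esup>\<close>,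
  and the polynomial grows at most like \<open>(\<bar>t\<bar>/r)\<^bsup>2n\<^esup>\<close> relative to its mean square over
  \<open>[r/2, r]\<close>. The product is a multiple of \<open>(r/t)\<^sup>2\<close>, whose integral is \<open>2r\<close>. On \<open>[r/2, r]\<close> the
  weight is at least \<open>e\<^bsup>-Q(r)-(c+\<bar>b\<bar>)r\<^esup>\<close>, so the factor \<open>e\<^bsup>-Q(r)\<^esup>\<close>, over which there is no
  control, cancels.
\<close>

lemma weighted_poly_tail_le:
  fixes p :: "complex poly" and Q u :: "real \<Rightarrow> real" and r c a b \<Lambda> :: real
  assumes n: "n \<ge> 1" and deg: "degree p \<le> n" and r: "r > 0" and c: "c \<ge> 0"
    and mono: "mono_on {r / 2..} (\<lambda>t. Q t + c * t)"
    and max: "\<And>t. t \<ge> r \<Longrightarrow>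
      t ^ (2 * n + 2) * exp (- Q t + \<Lambda> * t) \<le> 2 * (r ^ (2 * n + 2) * exp (- Q r + \<Lambda> * r))"
    and a: "\<bar>a\<bar> \<le> \<Lambda>"
    and u [measurable]: "u \<in> borel_measurable borel" and u_eq: "AE t in lborel. u t = exp (- Q \<bar>t\<bar>)"
  shows "(\<integral>\<^sup>+ t. ennreal (exp (a * t) * u t * (cmod (poly p (of_real t)))\<^sup>2) * indicator {t. r \<le> \<bar>t\<bar>} t \<partial>lborel)
    \<le> ennreal (8 * real (n + 1) * (64 * exp 4) ^ n * exp ((\<Lambda> + c + \<bar>b\<bar>) * r)) *
      (\<integral>\<^sup>+ t. ennreal (exp (b * t) * u t * (cmod (poly p (of_real t)))\<^sup>2) \<partial>lborel)"
proof -
  define f where "f t = (cmod (poly p (of_real t)))\<^sup>2" for t :: real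
  have f_nonneg: "f t \<ge> 0" for t by (simp add: f_def)
  have [measurable]: "f \<in> borel_measurable borel"
    unfolding f_def by (intro borel_measurable_continuous_onI continuous_intros)
  define C :: real where "C = (64 * exp 4) ^ n"
  have C: "C > 0" by (simp add: C_def)
  define J where "J = (\<integral>\<^sup>+ s. ennreal (f s) * indicator {r / 2..r} s \<partial>lborel)"
  define I where "I = (\<integral>\<^sup>+ t. ennreal (exp (b * t) * u t * f t) \<partial>lborel)"
  define v where "v = exp (- Q r + \<Lambda> * r)"
  define m where "m = exp (- Q r - (c + \<bar>b\<bar>) * r)"
  have upper: "ennreal (exp (a * t) * u t * f t) * indicator {t. r \<le> \<bar>t\<bar>} t
      \<le> ennreal (2 * v * C * (2 * real (n + 1) / r)) * J * (ennreal ((r / \<bar>t\<bar>)\<^sup>2) * indicator {t. r \<le> \<bar>t\<bar>} t)"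
    if "u t = exp (- Q \<bar>t\<bar>)" for t
  proof (cases "r \<le> \<bar>t\<bar>")
    case True
    then have t: "\<bar>t\<bar> > 0" using r by simp
    have "a * t \<le> \<Lambda> * \<bar>t\<bar>"
    proof -
      have "a * t \<le> \<bar>a\<bar> * \<bar>t\<bar>" by (metis abs_ge_self abs_mult)
      also have "\<dots> \<le> \<Lambda> * \<bar>t\<bar>" using a by (intro mult_right_mono) auto
      finally show ?thesis .
    qed
    then have "exp (a * t) * u t \<le> exp (- Q \<bar>t\<bar> + \<Lambda> * \<bar>t\<bar>)"
      using that by (simp flip: exp_add)
    also have "\<dots> \<le> 2 * v * (r / \<bar>t\<bar>) ^ (2 * n + 2)"
      using max[OF True] t unfolding v_def power_divide by (simp add: field_simps)
    finally have w: "exp (a * t) * u t \<le> 2 * v * (r / \<bar>t\<bar>) ^ (2 * n + 2)" .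
    have "ennreal (exp (a * t) * u t * f t) = ennreal (exp (a * t) * u t) * ennreal (f t)"
      using f_nonneg that by (intro ennreal_mult) auto
    also have "\<dots> \<le> ennreal (2 * v * (r / \<bar>t\<bar>) ^ (2 * n + 2))
        * (ennreal (C * (\<bar>t\<bar> / r) ^ (2 * n) * (2 * real (n + 1) / r)) * J)"
      unfolding f_def C_def J_def
      by (rule mult_mono[OF ennreal_leI[OF w] norm_poly_square_le_integral[OF n deg r True]]) auto
    also have "\<dots> = ennreal (2 * v * (r / \<bar>t\<bar>) ^ (2 * n + 2) * (C * (\<bar>t\<bar> / r) ^ (2 * n) * (2 * real (n + 1) / r))) * J"
      using r C by (subst ennreal_mult) (auto simp: v_def mult.assoc)
    also have "2 * v * (r / \<bar>t\<bar>) ^ (2 * n + 2) * (C * (\<bar>t\<bar> / r) ^ (2 * n) * (2 * real (n + 1) / r))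
        = 2 * v * C * (2 * real (n + 1) / r) * (r / \<bar>t\<bar>)\<^sup>2 * ((r / \<bar>t\<bar>) * (\<bar>t\<bar> / r)) ^ (2 * n)"
      by (simp only: power_mult_distrib power_add mult_ac)
    also have "(r / \<bar>t\<bar>) * (\<bar>t\<bar> / r) = 1" using r t by simp
    finally have "ennreal (exp (a * t) * u t * f t)
        \<le> ennreal (2 * v * C * (2 * real (n + 1) / r) * (r / \<bar>t\<bar>)\<^sup>2) * J" by simp
    also have "\<dots> = ennreal (2 * v * C * (2 * real (n + 1) / r)) * J * ennreal ((r / \<bar>t\<bar>)\<^sup>2)"
      using r C by (subst ennreal_mult) (auto simp: v_def mult_ac)
    finally show ?thesis using True by simp
  qed simp
  have "(\<integral>\<^sup>+ t. ennreal (exp (a * t) * u t * f t) * indicator {t. r \<le> \<bar>t\<bar>} t \<partial>lborel)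
      \<le> (\<integral>\<^sup>+ t. ennreal (2 * v * C * (2 * real (n + 1) / r)) * J * (ennreal ((r / \<bar>t\<bar>)\<^sup>2) * indicator {t. r \<le> \<bar>t\<bar>} t) \<partial>lborel)"
    by (rule nn_integral_mono_AE[OF eventually_mono[OF u_eq upper]])
  also have "\<dots> = ennreal (2 * v * C * (2 * real (n + 1) / r)) * J * ennreal (2 * r)"
    by (subst nn_integral_cmult) (auto simp: nn_integral_inverse_square_tail[OF r])
  also have "\<dots> = ennreal (2 * v * C * (2 * real (n + 1) / r) * (2 * r)) * J"
    using r C by (subst (2) ennreal_mult) (auto simp: v_def mult_ac)
  also have "2 * v * C * (2 * real (n + 1) / r) * (2 * r) = 8 * real (n + 1) * C * v"
    using r by simp
  finally have tail: "(\<integral>\<^sup>+ t. ennreal (exp (a * t) * u t * f t) * indicator {t. r \<le> \<bar>t\<bar>} t \<partial>lborel)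
      \<le> ennreal (8 * real (n + 1) * C * v) * J" .
  have lower: "ennreal m * (ennreal (f t) * indicator {r / 2..r} t) \<le> ennreal (exp (b * t) * u t * f t)"
    if "u t = exp (- Q \<bar>t\<bar>)" for t
  proof (cases "t \<in> {r / 2..r}")
    case True
    then have t: "t > 0" "\<bar>t\<bar> = t" using r by auto
    have "Q t + c * t \<le> Q r + c * r" using True r by (intro mono_onD[OF mono]) auto
    moreover have "c * t \<ge> 0" using c t by simp
    moreover have "- (\<bar>b\<bar> * r) \<le> b * t"
    proof -
      have "\<bar>b\<bar> * t \<le> \<bar>b\<bar> * r" using True by (intro mult_left_mono) auto
      moreover have "- (\<bar>b\<bar> * t) \<le> b * t" using t by (metis abs_ge_minus_self abs_mult minus_le_iff)
      ultimately show ?thesis by linarith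
    qed
    ultimately have "m \<le> exp (b * t) * u t"
      using that t by (simp add: m_def algebra_simps flip: exp_add)
    then have "m * f t \<le> exp (b * t) * u t * f t" by (intro mult_right_mono f_nonneg)
    then show ?thesis using True f_nonneg by (simp add: m_def ennreal_leI flip: ennreal_mult)
  qed simp
  have "ennreal m * J = (\<integral>\<^sup>+ t. ennreal m * (ennreal (f t) * indicator {r / 2..r} t) \<partial>lborel)"
    unfolding J_def by (subst nn_integral_cmult) auto
  also have "\<dots> \<le> I"
    unfolding I_def by (rule nn_integral_mono_AE[OF eventually_mono[OF u_eq lower]])
  finally have "ennreal (1 / m) * (ennreal m * J) \<le> ennreal (1 / m) * I"
    by (intro mult_left_mono) auto
  moreover have "ennreal (1 / m) * (ennreal m * J) = J"
    by (simp add: m_def mult.assoc[symmetric] flip: ennreal_mult)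
  ultimately have "J \<le> ennreal (1 / m) * I" by simp
  then have "ennreal (8 * real (n + 1) * C * v) * J \<le> ennreal (8 * real (n + 1) * C * v) * (ennreal (1 / m) * I)"
    by (rule mult_left_mono) simp
  also have "\<dots> = ennreal (8 * real (n + 1) * C * v * (1 / m)) * I"
    using C by (subst (2) ennreal_mult) (auto simp: v_def m_def mult.assoc)
  also have "8 * real (n + 1) * C * v * (1 / m) = 8 * real (n + 1) * C * exp ((\<Lambda> + c + \<bar>b\<bar>) * r)"
  proof -
    have "v * (1 / m) = exp ((- Q r + \<Lambda> * r) - (- Q r - (c + \<bar>b\<bar>) * r))"
      by (simp add: v_def m_def flip: exp_diff)
    also have "(- Q r + \<Lambda> * r) - (- Q r - (c + \<bar>b\<bar>) * r) = (\<Lambda> + c + \<bar>b\<bar>) * r"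
      by (simp add: algebra_simps)
    finally show ?thesis by (simp only: mult.assoc)
  qed
  finally show ?thesis using tail unfolding I_def f_def C_def by (rule order_trans[rotated])
qed

text \<open>
  The factors are: \<open>64 e\<^sup>4\<close> from interpolation, \<open>e\<close> from the exponentials \<open>e\<^bsup>O(r)\<^esup> \<le> e\<^sup>n\<close>, and \<open>17\<close>
  to absorb the linear prefactor, as \<open>1 + 8(n + 1) \<le> 17\<^sup>n\<close> for \<open>n \<ge> 1\<close>.
\<close>

definition one_variable_constant :: real where
  "one_variable_constant = 17 * (64 * exp 4) * exp 1"

text \<open>
  The constant must not depend on \<open>a\<close> and \<open>b\<close>, because one bound has to serve all exponents; only
  the threshold for \<open>n\<close> may. This is why
  \<open>r \<le> \<epsilon> n\<close> is needed with \<open>\<epsilon>\<close> so small that every exponential \<open>e\<^bsup>(\<bar>a\<bar>+c+\<bar>b\<bar>)r\<^esup>\<close> is at most \<open>e\<^sup>n\<close>.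
\<close>

lemma one_variable_comparison:
  fixes Q u :: "real \<Rightarrow> real" and a b :: real
  assumes mono: "\<exists>c. \<exists>T\<ge>0. mono_on {T..} (\<lambda>t. Q t + c * t)"
    and growth: "\<exists>R>0. filterlim (\<lambda>t. Q (t + R) - Q t) at_top at_top"
    and u [measurable]: "u \<in> borel_measurable borel" and u_eq: "AE t in lborel. u t = exp (- Q \<bar>t\<bar>)"
  shows "\<forall>\<^sub>F n in sequentially. \<forall>p::complex poly. degree p \<le> n \<longrightarrow>
    (\<integral>\<^sup>+ t. ennreal (exp (a * t) * u t * (cmod (poly p (of_real t)))\<^sup>2) \<partial>lborel)
    \<le> ennreal (one_variable_constant ^ n) *
      (\<integral>\<^sup>+ t. ennreal (exp (b * t) * u t * (cmod (poly p (of_real t)))\<^sup>2) \<partial>lborel)"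
proof -
  from mono obtain c0 T0 where T0: "T0 \<ge> 0" and mono0: "mono_on {T0..} (\<lambda>t. Q t + c0 * t)" by blast
  from growth obtain R where R: "R > 0" "filterlim (\<lambda>t. Q (t + R) - Q t) at_top at_top" by blast
  define c where "c = \<bar>c0\<bar>"
  \<comment> \<open>The interval \<open>[r/2, r]\<close> has to lie in the range where \<open>Q\<close> is nearly monotone.\<close>
  define T where "T = 2 * T0 + 1"
  have mono_half: "mono_on {r / 2..} (\<lambda>t. Q t + c * t)" if "r \<ge> T" for r
  proof (rule mono_onI)
    fix s t assume st: "s \<in> {r / 2..}" "t \<in> {r / 2..}" "s \<le> t"
    then have "Q s + c0 * s \<le> Q t + c0 * t" using that by (intro mono_onD[OF mono0]) (auto simp: T_def)
    moreover have "(c - c0) * s \<le> (c - c0) * t" using st by (intro mult_left_mono) (auto simp: c_def)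
    ultimately show "Q s + c * s \<le> Q t + c * t" by (simp add: algebra_simps)
  qed
  have mono_T: "mono_on {T..} (\<lambda>t. Q t + c * t)"
    using mono_half[of T] T0 by (auto intro: mono_on_subset simp: T_def)
  define \<Lambda> where "\<Lambda> = \<bar>a\<bar>"
  define \<epsilon> where "\<epsilon> = 1 / (\<Lambda> + c + \<bar>b\<bar> + 1)"
  have pos: "\<Lambda> \<ge> 0" "c \<ge> 0" by (auto simp: \<Lambda>_def c_def)
  have \<epsilon>: "\<epsilon> > 0" using pos by (simp add: \<epsilon>_def)
  have "T > 0" using T0 by (simp add: T_def)
  from near_maximizer[OF this pos(2) mono_T R pos(1) \<epsilon>] eventually_ge_at_top[of "1::nat"]
  show ?thesis
  proof eventually_elim
    case (elim n)
    then obtain r where r: "T \<le> r" "r \<le> \<epsilon> * real n" and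
      max: "\<And>t. t \<ge> r \<Longrightarrow>
        t ^ (2 * n + 2) * exp (- Q t + \<Lambda> * t) \<le> 2 * (r ^ (2 * n + 2) * exp (- Q r + \<Lambda> * r))"
      by blast
    have r_pos: "r > 0" using r \<open>T > 0\<close> by simp
    have "(\<Lambda> + c + \<bar>b\<bar> + 1) * r \<le> (\<Lambda> + c + \<bar>b\<bar> + 1) * (\<epsilon> * real n)"
      using r pos by (intro mult_left_mono) auto
    also have "\<dots> = real n"
      using \<epsilon> pos by (simp add: \<epsilon>_def)
    finally have "(\<Lambda> + c + \<bar>b\<bar>) * r \<le> real n" using r_pos by (simp add: algebra_simps)
    then have exp_r: "exp ((\<Lambda> + c + \<bar>b\<bar>) * r) \<le> exp 1 ^ n" by (simp flip: exp_of_nat_mult)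
    show ?case
    proof (intro allI impI)
      fix p :: "complex poly" assume deg: "degree p \<le> n"
      define f where "f t = (cmod (poly p (of_real t)))\<^sup>2" for t :: real
      have f_nonneg: "f t \<ge> 0" for t by (simp add: f_def)
      have [measurable]: "f \<in> borel_measurable borel"
        unfolding f_def by (intro borel_measurable_continuous_onI continuous_intros)
      define I where "I = (\<integral>\<^sup>+ t. ennreal (exp (b * t) * u t * f t) \<partial>lborel)"
      have near: "ennreal (exp (a * t) * u t * f t) * indicator {t. \<bar>t\<bar> < r} t
          \<le> ennreal (exp 1 ^ n) * ennreal (exp (b * t) * u t * f t)" if "u t = exp (- Q \<bar>t\<bar>)" for t
      proof (cases "\<bar>t\<bar> < r")
        case True
        have "(a - b) * t \<le> (\<bar>a\<bar> + \<bar>b\<bar>) * r"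
        proof -
          have "(a - b) * t \<le> \<bar>a - b\<bar> * \<bar>t\<bar>" by (metis abs_ge_self abs_mult)
          also have "\<dots> \<le> (\<bar>a\<bar> + \<bar>b\<bar>) * r" using True by (intro mult_mono) auto
          finally show ?thesis .
        qed
        also have "\<dots> \<le> (\<Lambda> + c + \<bar>b\<bar>) * r" using pos r_pos by (intro mult_right_mono) (auto simp: \<Lambda>_def)
        finally have "exp ((a - b) * t) \<le> exp 1 ^ n" using exp_r by (meson exp_le_cancel_iff order_trans)
        then have "exp ((a - b) * t) * (exp (b * t) * u t * f t) \<le> exp 1 ^ n * (exp (b * t) * u t * f t)"
          using that f_nonneg by (intro mult_right_mono) auto
        moreover have "exp (a * t) = exp ((a - b) * t) * exp (b * t)"
          by (simp add: left_diff_distrib flip: exp_add)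
        ultimately have "exp (a * t) * u t * f t \<le> exp 1 ^ n * (exp (b * t) * u t * f t)"
          by (simp only: mult.assoc)
        then have "ennreal (exp (a * t) * u t * f t) \<le> ennreal (exp 1 ^ n * (exp (b * t) * u t * f t))"
          by (rule ennreal_leI)
        also have "\<dots> = ennreal (exp 1 ^ n) * ennreal (exp (b * t) * u t * f t)"
          using that f_nonneg by (intro ennreal_mult) auto
        finally show ?thesis using True by simp
      qed simp
      have "(\<integral>\<^sup>+ t. ennreal (exp (a * t) * u t * f t) \<partial>lborel)
          = (\<integral>\<^sup>+ t. ennreal (exp (a * t) * u t * f t) * indicator {t. \<bar>t\<bar> < r} t
            + ennreal (exp (a * t) * u t * f t) * indicator {t. r \<le> \<bar>t\<bar>} t \<partial>lborel)"
        by (intro nn_integral_cong) (auto simp: indicator_def)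
      also have "\<dots> = (\<integral>\<^sup>+ t. ennreal (exp (a * t) * u t * f t) * indicator {t. \<bar>t\<bar> < r} t \<partial>lborel)
          + (\<integral>\<^sup>+ t. ennreal (exp (a * t) * u t * f t) * indicator {t. r \<le> \<bar>t\<bar>} t \<partial>lborel)"
        by (intro nn_integral_add) measurable
      also have "\<dots> \<le> ennreal (exp 1 ^ n) * I
          + ennreal (8 * real (n + 1) * (64 * exp 4) ^ n * exp ((\<Lambda> + c + \<bar>b\<bar>) * r)) * I"
      proof (rule add_mono)
        have "(\<integral>\<^sup>+ t. ennreal (exp (a * t) * u t * f t) * indicator {t. \<bar>t\<bar> < r} t \<partial>lborel)
            \<le> (\<integral>\<^sup>+ t. ennreal (exp 1 ^ n) * ennreal (exp (b * t) * u t * f t) \<partial>lborel)"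
          by (rule nn_integral_mono_AE[OF eventually_mono[OF u_eq near]])
        also have "\<dots> = ennreal (exp 1 ^ n) * I" unfolding I_def by (intro nn_integral_cmult) measurable
        finally show "(\<integral>\<^sup>+ t. ennreal (exp (a * t) * u t * f t) * indicator {t. \<bar>t\<bar> < r} t \<partial>lborel)
            \<le> ennreal (exp 1 ^ n) * I" .
        show "(\<integral>\<^sup>+ t. ennreal (exp (a * t) * u t * f t) * indicator {t. r \<le> \<bar>t\<bar>} t \<partial>lborel)
            \<le> ennreal (8 * real (n + 1) * (64 * exp 4) ^ n * exp ((\<Lambda> + c + \<bar>b\<bar>) * r)) * I"
          unfolding f_def I_def
          by (intro weighted_poly_tail_le[OF elim(2) deg r_pos pos(2) mono_half[OF r(1)] max _ u u_eq])
             (auto simp: \<Lambda>_def)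
      qed
      also have "\<dots> = ennreal (exp 1 ^ n + 8 * real (n + 1) * (64 * exp 4) ^ n * exp ((\<Lambda> + c + \<bar>b\<bar>) * r)) * I"
        by (subst ennreal_plus) (auto simp: distrib_right)
      also have "\<dots> \<le> ennreal (one_variable_constant ^ n) * I"
      proof (intro mult_right_mono ennreal_leI)
        define E :: real where "E = (64 * exp 4) ^ n"
        have E: "E \<ge> 1"
        proof -
          have "exp 4 \<ge> (1::real)" by simp
          then show ?thesis unfolding E_def by (intro one_le_power) linarith
        qed
        have "exp 1 ^ n + 8 * real (n + 1) * E * exp ((\<Lambda> + c + \<bar>b\<bar>) * r)
            \<le> E * exp 1 ^ n + 8 * real (n + 1) * E * exp 1 ^ n"
          using E exp_r by (intro add_mono mult_left_mono) auto
        also have "\<dots> = (1 + 8 * real (n + 1)) * (E * exp 1 ^ n)" by (simp add: algebra_simps)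
        also have "\<dots> \<le> 17 ^ n * (E * exp 1 ^ n)"
        proof (intro mult_right_mono)
          have "1 + real n * 16 \<le> (1 + 16) ^ n" by (rule Bernoulli_inequality) simp
          then show "1 + 8 * real (n + 1) \<le> 17 ^ n" using elim by simp
        qed (use E in auto)
        also have "\<dots> = one_variable_constant ^ n"
          by (simp only: one_variable_constant_def E_def power_mult_distrib mult.assoc mult.left_commute)
        finally show "exp 1 ^ n + 8 * real (n + 1) * (64 * exp 4) ^ n * exp ((\<Lambda> + c + \<bar>b\<bar>) * r)
            \<le> one_variable_constant ^ n" unfolding E_def .
      qed auto
      finally show "(\<integral>\<^sup>+ t. ennreal (exp (a * t) * u t * (cmod (poly p (of_real t)))\<^sup>2) \<partial>lborel)
        \<le> ennreal (one_variable_constant ^ n) *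
          (\<integral>\<^sup>+ t. ennreal (exp (b * t) * u t * (cmod (poly p (of_real t)))\<^sup>2) \<partial>lborel)"
        unfolding f_def I_def .
    qed
  qed
qed

section \<open>Comparing integrals line by line\<close>

text \<open>
  This disintegrates Lebesgue measure into lines in direction \<open>b\<close> without factoring the space as
  a product. By Tonelli and translation invariance, summing the line integrals over all lines
  through the slab \<open>0 \<le> x \<bullet> b \<le> 1\<close> counts each value \<open>f x\<close> with weight equal to the length of the
  set of \<open>t\<close> such that \<open>x - t b\<close> is in the slab, which is \<open>1\<close>.
\<close>

lemma nn_integral_lborel_lines:
  fixes f :: "'a::euclidean_space \<Rightarrow> ennreal" and b :: 'a
  assumes [measurable]: "f \<in> borel_measurable borel" and b: "b \<in> Basis"
  shows "(\<integral>\<^sup>+ x. f x \<partial>lborel) =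
    (\<integral>\<^sup>+ x. indicator {0..1} (x \<bullet> b) * (\<integral>\<^sup>+ t. f ((x - (x \<bullet> b) *\<^sub>R b) + t *\<^sub>R b) \<partial>lborel) \<partial>lborel)"
proof -
  have "(\<integral>\<^sup>+ x. indicator {0..1} (x \<bullet> b) * (\<integral>\<^sup>+ t. f ((x - (x \<bullet> b) *\<^sub>R b) + t *\<^sub>R b) \<partial>lborel) \<partial>lborel)
      = (\<integral>\<^sup>+ x. (\<integral>\<^sup>+ t. indicator {0..1} (x \<bullet> b) * f (x + t *\<^sub>R b) \<partial>lborel) \<partial>lborel)"
  proof (intro nn_integral_cong)
    fix x :: 'a
    have "(\<integral>\<^sup>+ t. f ((x - (x \<bullet> b) *\<^sub>R b) + t *\<^sub>R b) \<partial>lborel)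
        = (\<integral>\<^sup>+ t. f ((x - (x \<bullet> b) *\<^sub>R b) + (x \<bullet> b + 1 * t) *\<^sub>R b) \<partial>lborel)"
      by (subst nn_integral_real_affine[where c = 1 and t = "x \<bullet> b"]) auto
    also have "\<dots> = (\<integral>\<^sup>+ t. f (x + t *\<^sub>R b) \<partial>lborel)"
      by (simp add: scaleR_add_left)
    finally show "indicator {0..1} (x \<bullet> b) * (\<integral>\<^sup>+ t. f ((x - (x \<bullet> b) *\<^sub>R b) + t *\<^sub>R b) \<partial>lborel)
      = (\<integral>\<^sup>+ t. indicator {0..1} (x \<bullet> b) * f (x + t *\<^sub>R b) \<partial>lborel)"
      by (subst nn_integral_cmult) auto
  qed
  also have "\<dots> = (\<integral>\<^sup>+ t. (\<integral>\<^sup>+ x. indicator {0..1} (x \<bullet> b) * f (x + t *\<^sub>R b) \<partial>lborel) \<partial>lborel)"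
    by (rule lborel_pair.Fubini') measurable
  also have "\<dots> = (\<integral>\<^sup>+ t. (\<integral>\<^sup>+ x. indicator {0..1} (x \<bullet> b - t) * f x \<partial>lborel) \<partial>lborel)"
  proof (rule nn_integral_cong)
    fix t :: real
    have "(\<integral>\<^sup>+ x. indicator {0..1} (x \<bullet> b - t) * f x \<partial>lborel)
        = (\<integral>\<^sup>+ x. indicator {0..1} (x \<bullet> b - t) * f x \<partial>distr lborel borel ((+) (t *\<^sub>R b)))"
      by (simp only: lborel_distr_plus)
    also have "\<dots> = (\<integral>\<^sup>+ x. indicator {0..1} (x \<bullet> b) * f (x + t *\<^sub>R b) \<partial>lborel)"
      using b by (subst nn_integral_distr) (auto simp: inner_add_left add.commute)
    finally show "(\<integral>\<^sup>+ x. indicator {0..1} (x \<bullet> b) * f (x + t *\<^sub>R b) \<partial>lborel)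
      = (\<integral>\<^sup>+ x. indicator {0..1} (x \<bullet> b - t) * f x \<partial>lborel)" ..
  qed
  also have "\<dots> = (\<integral>\<^sup>+ x. (\<integral>\<^sup>+ t. indicator {0..1} (x \<bullet> b - t) * f x \<partial>lborel) \<partial>lborel)"
    by (rule lborel_pair.Fubini') measurable
  also have "\<dots> = (\<integral>\<^sup>+ x. f x \<partial>lborel)"
  proof (rule nn_integral_cong)
    fix x :: 'a
    have "(\<integral>\<^sup>+ t. indicator {0..1} (x \<bullet> b - t) * f x \<partial>lborel)
        = (\<integral>\<^sup>+ t. f x * indicator {x \<bullet> b - 1..x \<bullet> b} t \<partial>lborel)"
      by (intro nn_integral_cong) (auto simp: indicator_def)
    also have "\<dots> = f x" by (subst nn_integral_cmult) auto
    finally show "(\<integral>\<^sup>+ t. indicator {0..1} (x \<bullet> b - t) * f x \<partial>lborel) = f x" .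
  qed
  finally show ?thesis ..
qed

lemma nn_integral_le_from_lines:
  fixes f g :: "'a::euclidean_space \<Rightarrow> ennreal" and b :: 'a
  assumes [measurable]: "f \<in> borel_measurable borel" "g \<in> borel_measurable borel" and b: "b \<in> Basis"
    and le: "\<And>x. x \<bullet> b = 0 \<Longrightarrow>
      (\<integral>\<^sup>+ t. f (x + t *\<^sub>R b) \<partial>lborel) \<le> K * (\<integral>\<^sup>+ t. g (x + t *\<^sub>R b) \<partial>lborel)"
  shows "(\<integral>\<^sup>+ x. f x \<partial>lborel) \<le> K * (\<integral>\<^sup>+ x. g x \<partial>lborel)"
proof -
  let ?S = "\<lambda>h x. \<integral>\<^sup>+ t. h ((x - (x \<bullet> b) *\<^sub>R b) + t *\<^sub>R b) \<partial>lborel"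
  have "(\<integral>\<^sup>+ x. f x \<partial>lborel) = (\<integral>\<^sup>+ x. indicator {0..1} (x \<bullet> b) * ?S f x \<partial>lborel)"
    using b by (intro nn_integral_lborel_lines) auto
  also have "\<dots> \<le> (\<integral>\<^sup>+ x. K * (indicator {0..1} (x \<bullet> b) * ?S g x) \<partial>lborel)"
  proof (intro nn_integral_mono)
    fix x :: 'a
    have "?S f x \<le> K * ?S g x" using b by (intro le) (simp add: inner_diff_left)
    then show "indicator {0..1} (x \<bullet> b) * ?S f x \<le> K * (indicator {0..1} (x \<bullet> b) * ?S g x)"
      by (simp add: indicator_def)
  qed
  also have "\<dots> = K * (\<integral>\<^sup>+ x. indicator {0..1} (x \<bullet> b) * ?S g x \<partial>lborel)"
    by (intro nn_integral_cmult) measurable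
  also have "\<dots> = K * (\<integral>\<^sup>+ x. g x \<partial>lborel)"
    using b by (subst nn_integral_lborel_lines[of g b]) auto
  finally show ?thesis .
qed

text \<open>
  A cylinder over a null set is null, because every line in direction \<open>b\<close> meets it in a null set.
\<close>

lemma AE_lborel_coordinate:
  fixes b :: "'a::euclidean_space"
  assumes "AE t in lborel. P t" and b: "b \<in> Basis"
  shows "AE x in lborel. P (x \<bullet> b)"
proof -
  from assms(1) obtain N where N: "{t. \<not> P t} \<subseteq> N" "N \<in> sets lborel" "emeasure lborel N = 0"
    by (auto elim!: AE_E)
  then have [measurable]: "N \<in> sets borel" by simp
  have "(\<integral>\<^sup>+ x. indicator N (x \<bullet> b) \<partial>lborel) \<le> 0 * (\<integral>\<^sup>+ x. 0 \<partial>(lborel :: 'a measure))"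
  proof (rule nn_integral_le_from_lines[OF _ _ b])
    fix x :: 'a assume "x \<bullet> b = 0"
    then have "(\<integral>\<^sup>+ t. indicator N ((x + t *\<^sub>R b) \<bullet> b) \<partial>lborel) = (\<integral>\<^sup>+ t. indicator N t \<partial>lborel)"
      using b by (simp add: inner_add_left)
    then show "(\<integral>\<^sup>+ t. indicator N ((x + t *\<^sub>R b) \<bullet> b) \<partial>lborel) \<le> 0 * (\<integral>\<^sup>+ t. 0 \<partial>lborel)"
      using N by simp
  qed measurable
  then have "AE x in (lborel :: 'a measure). indicator N (x \<bullet> b) = (0::ennreal)"
    by (subst (asm) mult_zero_left, subst (asm) le_zero_eq, subst (asm) nn_integral_0_iff_AE) auto
  then show ?thesis
    by (rule eventually_mono) (use N(1) in \<open>auto simp: indicator_def split: if_splits\<close>)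
qed

section \<open>Exchanging exponents coordinate by coordinate\<close>

lemma poly_space_on_axis_parallel_line:
  fixes \<xi> :: "real ^ 'd"
  assumes "P \<in> poly_space n" and \<xi>: "\<xi> $ i = 0"
  shows "\<exists>p. degree p \<le> n \<and> (\<forall>t. P (\<xi> + t *\<^sub>R axis i 1) = poly p (of_real t))"
proof -
  from assms(1) obtain c where P: "P = (\<lambda>\<xi>. \<Sum>\<alpha> | (\<Sum>i\<in>UNIV. \<alpha> i) \<le> n.
      c \<alpha> * (\<Prod>i\<in>UNIV. complex_of_real (\<xi> $ i) ^ \<alpha> i))"
    unfolding poly_space_def by blast
  define p where "p = (\<Sum>\<alpha> | (\<Sum>i\<in>UNIV. \<alpha> i) \<le> n.
      monom (c \<alpha> * (\<Prod>j\<in>UNIV - {i}. complex_of_real (\<xi> $ j) ^ \<alpha> j)) (\<alpha> i))"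
  have "finite {\<alpha> :: 'd \<Rightarrow> nat. (\<Sum>i\<in>UNIV. \<alpha> i) \<le> n}"
  proof (rule finite_subset)
    show "{\<alpha> :: 'd \<Rightarrow> nat. (\<Sum>i\<in>UNIV. \<alpha> i) \<le> n} \<subseteq> (\<Pi>\<^sub>E i\<in>UNIV. {..n})"
    proof (intro subsetI PiE_I)
      fix \<alpha> :: "'d \<Rightarrow> nat" and j
      assume "\<alpha> \<in> {\<alpha>. (\<Sum>i\<in>UNIV. \<alpha> i) \<le> n}"
      then show "\<alpha> j \<in> {..n}" using member_le_sum[of j UNIV \<alpha>] by simp
    qed simp
  qed (intro finite_PiE; simp)
  then have "degree p \<le> n"
    unfolding p_def
  proof (rule degree_sum_le)
    fix \<alpha> :: "'d \<Rightarrow> nat" assume "\<alpha> \<in> {\<alpha>. (\<Sum>i\<in>UNIV. \<alpha> i) \<le> n}"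
    then have "\<alpha> i \<le> n" using member_le_sum[of i UNIV \<alpha>] by simp
    then show "degree (monom (c \<alpha> * (\<Prod>j\<in>UNIV - {i}. complex_of_real (\<xi> $ j) ^ \<alpha> j)) (\<alpha> i)) \<le> n"
      using degree_monom_le order_trans by blast
  qed
  moreover have "P (\<xi> + t *\<^sub>R axis i 1) = poly p (of_real t)" for t
  proof -
    have "(\<Prod>j\<in>UNIV. complex_of_real ((\<xi> + t *\<^sub>R axis i 1) $ j) ^ \<alpha> j)
        = complex_of_real t ^ \<alpha> i * (\<Prod>j\<in>UNIV - {i}. complex_of_real (\<xi> $ j) ^ \<alpha> j)" for \<alpha> :: "'d \<Rightarrow> nat"
      using \<xi> by (subst prod.remove[of _ i]) (auto simp: axis_def intro!: prod.cong)
    then show ?thesis by (simp add: P p_def poly_sum poly_monom mult_ac)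
  qed
  ultimately show ?thesis by blast
qed

lemma borel_measurable_poly_space:
  fixes P :: "real ^ 'd \<Rightarrow> complex"
  assumes "P \<in> poly_space n"
  shows "P \<in> borel_measurable borel"
proof -
  from assms obtain c where P: "P = (\<lambda>\<xi>. \<Sum>\<alpha> | (\<Sum>i\<in>UNIV. \<alpha> i) \<le> n.
      c \<alpha> * (\<Prod>i\<in>UNIV. complex_of_real (\<xi> $ i) ^ \<alpha> i))"
    unfolding poly_space_def by blast
  show ?thesis unfolding P by (intro borel_measurable_continuous_onI continuous_intros)
qed

context
  fixes Q u :: "'d::finite \<Rightarrow> real \<Rightarrow> real"
  assumes mono: "\<And>i. \<exists>c. \<exists>T\<ge>0. mono_on {T..} (\<lambda>t. Q i t + c * t)"
    and growth: "\<And>i. \<exists>R>0. filterlim (\<lambda>t. Q i (t + R) - Q i t) at_top at_top"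
    and u: "\<And>i. u i \<in> borel_measurable borel" "\<And>i t. u i t \<ge> 0"
    and u_eq: "\<And>i. AE t in lborel. u i t = exp (- Q i \<bar>t\<bar>)"
begin

text \<open>
  On a line parallel to the \<open>i\<close>-th axis every factor of the integrand other than the \<open>i\<close>-th weight
  and exponential is constant, and \<open>P\<close> is a polynomial of degree at most \<open>n\<close> in one variable.
\<close>

lemma change_one_exponent:
  fixes a b :: "real ^ 'd" and i :: 'd
  assumes ab: "\<And>j. j \<noteq> i \<Longrightarrow> a $ j = b $ j"
  shows "\<forall>\<^sub>F n in sequentially. \<forall>P\<in>poly_space n.
    (\<integral>\<^sup>+ \<xi>. ennreal (exp (a \<bullet> \<xi>) * (\<Prod>j\<in>UNIV. u j (\<xi> $ j)) * (cmod (P \<xi>))\<^sup>2) \<partial>lborel)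
    \<le> ennreal (one_variable_constant ^ n) *
      (\<integral>\<^sup>+ \<xi>. ennreal (exp (b \<bullet> \<xi>) * (\<Prod>j\<in>UNIV. u j (\<xi> $ j)) * (cmod (P \<xi>))\<^sup>2) \<partial>lborel)"
  using one_variable_comparison[OF mono[of i] growth[of i] u(1)[of i] u_eq[of i], of "a $ i" "b $ i"]
proof eventually_elim
  case (elim n)
  note [measurable] = u(1)
  show ?case
  proof
    fix P :: "real ^ 'd \<Rightarrow> complex" assume P: "P \<in> poly_space n"
    note [measurable] = borel_measurable_poly_space[OF P]
    let ?f = "\<lambda>(a :: real ^ 'd) \<xi>. ennreal (exp (a \<bullet> \<xi>) * (\<Prod>j\<in>UNIV. u j (\<xi> $ j)) * (cmod (P \<xi>))\<^sup>2)"
    show "(\<integral>\<^sup>+ \<xi>. ?f a \<xi> \<partial>lborel) \<le> ennreal (one_variable_constant ^ n) * (\<integral>\<^sup>+ \<xi>. ?f b \<xi> \<partial>lborel)"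
    proof (rule nn_integral_le_from_lines)
      show "axis i (1::real) \<in> Basis" by (simp add: axis_in_Basis_iff)
      fix \<xi> :: "real ^ 'd" assume "\<xi> \<bullet> axis i 1 = 0"
      then have \<xi>: "\<xi> $ i = 0" by (simp add: inner_axis)
      obtain p where deg: "degree p \<le> n" and p: "\<And>t. P (\<xi> + t *\<^sub>R axis i 1) = poly p (of_real t)"
        using poly_space_on_axis_parallel_line[OF P \<xi>] by blast
      have [measurable]: "(\<lambda>t. poly p (complex_of_real t)) \<in> borel_measurable borel"
        by (intro borel_measurable_continuous_onI continuous_intros)
      define G where "G = exp (b \<bullet> \<xi>) * (\<Prod>j\<in>UNIV - {i}. u j (\<xi> $ j))"
      have G: "G \<ge> 0" by (auto simp: G_def intro!: mult_nonneg_nonneg prod_nonneg u)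
      have line: "?f e (\<xi> + t *\<^sub>R axis i 1)
          = ennreal G * ennreal (exp (e $ i * t) * u i t * (cmod (poly p (of_real t)))\<^sup>2)"
        if "e \<bullet> \<xi> = b \<bullet> \<xi>" for e t
      proof -
        have "(\<Prod>j\<in>UNIV. u j ((\<xi> + t *\<^sub>R axis i 1) $ j)) = u i t * (\<Prod>j\<in>UNIV - {i}. u j (\<xi> $ j))"
          using \<xi> by (subst prod.remove[of _ i]) (auto simp: axis_def intro!: prod.cong)
        moreover have "exp (e \<bullet> (\<xi> + t *\<^sub>R axis i 1)) = exp (b \<bullet> \<xi>) * exp (e $ i * t)"
          using that by (simp add: inner_add_right inner_axis exp_add mult.commute)
        ultimately show ?thesis
          using G u(2) by (simp add: p G_def mult_ac flip: ennreal_mult)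
      qed
      have "a \<bullet> \<xi> = b \<bullet> \<xi>"
        unfolding inner_vec_def using ab \<xi> by (intro sum.cong) (metis inner_real_def mult_zero_right)+
      then have "(\<integral>\<^sup>+ t. ?f a (\<xi> + t *\<^sub>R axis i 1) \<partial>lborel)
          = ennreal G * (\<integral>\<^sup>+ t. ennreal (exp (a $ i * t) * u i t * (cmod (poly p (of_real t)))\<^sup>2) \<partial>lborel)"
        by (simp only: line) (intro nn_integral_cmult; measurable)
      also have "\<dots> \<le> ennreal G * (ennreal (one_variable_constant ^ n) *
          (\<integral>\<^sup>+ t. ennreal (exp (b $ i * t) * u i t * (cmod (poly p (of_real t)))\<^sup>2) \<partial>lborel))"
        using elim deg by (intro mult_left_mono) auto
      also have "\<dots> = ennreal (one_variable_constant ^ n) * (\<integral>\<^sup>+ t. ?f b (\<xi> + t *\<^sub>R axis i 1) \<partial>lborel)"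
        using line[OF refl] by (simp only:) (subst nn_integral_cmult; simp add: mult.left_commute)
      finally show "(\<integral>\<^sup>+ t. ?f a (\<xi> + t *\<^sub>R axis i 1) \<partial>lborel)
        \<le> ennreal (one_variable_constant ^ n) * (\<integral>\<^sup>+ t. ?f b (\<xi> + t *\<^sub>R axis i 1) \<partial>lborel)" .
    qed measurable
  qed
qed

text \<open>
  The exponents pass from \<open>a\<close> to \<open>b\<close> through vectors \<open>h S\<close> that have already switched to \<open>b\<close> on
  the coordinates in \<open>S\<close>.
\<close>

lemma change_exponent:
  fixes a b :: "real ^ 'd"
  shows "\<forall>\<^sub>F n in sequentially. \<forall>P\<in>poly_space n.
    (\<integral>\<^sup>+ \<xi>. ennreal (exp (a \<bullet> \<xi>) * (\<Prod>j\<in>UNIV. u j (\<xi> $ j)) * (cmod (P \<xi>))\<^sup>2) \<partial>lborel)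
    \<le> ennreal ((one_variable_constant ^ CARD('d)) ^ n) *
      (\<integral>\<^sup>+ \<xi>. ennreal (exp (b \<bullet> \<xi>) * (\<Prod>j\<in>UNIV. u j (\<xi> $ j)) * (cmod (P \<xi>))\<^sup>2) \<partial>lborel)"
proof -
  define I where "I e P = (\<integral>\<^sup>+ \<xi>. ennreal (exp (e \<bullet> \<xi>) * (\<Prod>j\<in>UNIV. u j (\<xi> $ j)) * (cmod (P \<xi>))\<^sup>2) \<partial>lborel)"
    for e :: "real ^ 'd" and P
  define h :: "'d set \<Rightarrow> real ^ 'd" where "h S = (\<chi> j. if j \<in> S then b $ j else a $ j)" for S
  have K: "one_variable_constant \<ge> 0" by (simp add: one_variable_constant_def)
  have "\<forall>\<^sub>F n in sequentially. \<forall>P\<in>poly_space n.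
      I a P \<le> ennreal ((one_variable_constant ^ card S) ^ n) * I (h S) P" for S
  proof (induction S rule: finite_induct[OF finite])
    case 1
    have "h {} = a" by (simp add: h_def vec_eq_iff)
    then show ?case by simp
  next
    case (2 i S)
    have "\<forall>\<^sub>F n in sequentially. \<forall>P\<in>poly_space n.
        I (h S) P \<le> ennreal (one_variable_constant ^ n) * I (h (insert i S)) P"
      unfolding I_def by (rule change_one_exponent[where i = i]) (simp add: h_def)
    with 2(3) show ?case
    proof eventually_elim
      case (elim n)
      show ?case
      proof
        fix P :: "real ^ 'd \<Rightarrow> complex" assume P: "P \<in> poly_space n"
        have "I a P \<le> ennreal ((one_variable_constant ^ card S) ^ n) * I (h S) P"
          using elim P by blast
        also have "\<dots> \<le> ennreal ((one_variable_constant ^ card S) ^ n) *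
            (ennreal (one_variable_constant ^ n) * I (h (insert i S)) P)"
          using elim P by (intro mult_left_mono) auto
        also have "\<dots> = ennreal ((one_variable_constant ^ card (insert i S)) ^ n) * I (h (insert i S)) P"
          using 2 K by (simp add: mult.assoc[symmetric] power_mult_distrib mult.commute flip: ennreal_mult)
        finally show "I a P \<le> ennreal ((one_variable_constant ^ card (insert i S)) ^ n) * I (h (insert i S)) P" .
      qed
    qed
  qed
  from this[of UNIV] show ?thesis by (simp add: h_def I_def vec_lambda_eta)
qed

end

section \<open>Exponential growth rates\<close>

lemma ennreal_root_le:
  assumes n: "n > 0" and K: "K > 0" and le: "x \<le> ennreal (K ^ n) * y"
  shows "ennreal_root n x \<le> ennreal K * ennreal_root n y"
proof (cases "y = top")
  case True
  then show ?thesis using K by (simp add: ennreal_root_def ennreal_mult_top)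
next
  case False
  then obtain b where b: "y = ennreal b" "b \<ge> 0" by (cases y) auto
  then have "ennreal (K ^ n) * y = ennreal (K ^ n * b)" using K by (simp add: ennreal_mult)
  then obtain a where a: "x = ennreal a" "a \<ge> 0" using le by (cases x) (auto simp: top_unique)
  have "a \<le> K ^ n * b" using le a b K by (simp flip: ennreal_mult)
  then have "root n a \<le> root n (K ^ n * b)" using n by simp
  also have "\<dots> = K * root n b" using n K by (simp add: real_root_mult real_root_power_cancel)
  finally show ?thesis using a b K n by (simp add: ennreal_root_def ennreal_leI flip: ennreal_mult)
qed

lemma L2_norm_le:
  assumes K: "K > 0" and le: "(\<integral>\<^sup>+ \<xi>. ennreal ((cmod (f \<xi>))\<^sup>2) \<partial>weight_measure w)
    \<le> ennreal (K\<^sup>2) * (\<integral>\<^sup>+ \<xi>. ennreal ((cmod (g \<xi>))\<^sup>2) \<partial>weight_measure w)"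
  shows "L2_norm w f \<le> ennreal K * L2_norm w g"
  unfolding L2_norm_def by (rule ennreal_root_le[OF _ K le]) simp

text \<open>
  The convention \<open>0 / 0 = x / top = 0\<close> makes the bound hold for degenerate \<open>y\<close> as well.
\<close>

lemma ennreal_divide_le:
  fixes x y c :: ennreal
  assumes "x \<le> c * y"
  shows "x / y \<le> c"
proof (cases "y = 0 \<or> y = top")
  case True
  then show ?thesis using assms by (auto simp: divide_ennreal_def)
next
  case False
  have "x / y \<le> c * y / y" by (intro divide_right_mono_ennreal assms)
  also have "\<dots> = c" using False by (simp add: ennreal_mult_divide_eq)
  finally show ?thesis .
qed

text \<open>
  The one-variable estimates and Tonelli are stated for Borel functions, whereas \<open>Q\<close> is only
  Lebesgue measurable.
\<close>

lemma borel_version_of_even_weight: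
  fixes Q :: "real \<Rightarrow> real"
  assumes "Q \<in> borel_measurable (lebesgue_on {0..})"
  shows "\<exists>u\<in>borel_measurable borel. (\<forall>t. 0 \<le> u t) \<and> (AE t in lborel. u t = exp (- Q \<bar>t\<bar>))"
proof -
  have "(\<lambda>t. if t \<in> {0..} then Q t else 0) \<in> borel_measurable lebesgue"
    using assms by (rule borel_measurable_if_I) simp
  then obtain q where q [measurable]: "q \<in> borel_measurable borel"
    and q_eq: "AE t in lborel. (if t \<in> {0..} then Q t else 0) = q t"
    using completion_ex_borel_measurable_real by force
  have "AE t in lborel. (if - t \<in> {0..} then Q (- t) else 0) = q (- t)"
  proof -
    have "AE t in distr lborel borel uminus. (if t \<in> {0..} then Q t else 0) = q t"
      using q_eq by (simp only: lborel_distr_uminus)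
    then show ?thesis by (rule AE_distrD[rotated]) simp
  qed
  with q_eq have "AE t in lborel. exp (- q \<bar>t\<bar>) = exp (- Q \<bar>t\<bar>)"
    by eventually_elim (auto simp: abs_if split: if_splits)
  then show ?thesis by (intro bexI[of _ "\<lambda>t. exp (- q \<bar>t\<bar>)"]) auto
qed

text \<open>
  Squaring the modulus of \<open>m\<^sub>y P\<close> doubles the exponent.
\<close>

lemma nn_integral_weight_measure_mult_exp:
  fixes w :: "real ^ 'd \<Rightarrow> real" and u :: "'d \<Rightarrow> real \<Rightarrow> real"
  assumes w: "w \<in> borel_measurable lebesgue"
    and w_eq: "AE \<xi> in lborel. w \<xi> = (\<Prod>j\<in>UNIV. u j (\<xi> $ j))"
    and u [measurable]: "\<And>i. u i \<in> borel_measurable borel" and u_nonneg: "\<And>i t. u i t \<ge> 0"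
    and P: "P \<in> poly_space n"
  shows "(\<integral>\<^sup>+ \<xi>. ennreal ((cmod (mult_exp y P \<xi>))\<^sup>2) \<partial>weight_measure w) =
    (\<integral>\<^sup>+ \<xi>. ennreal (exp ((2 *\<^sub>R y) \<bullet> \<xi>) * (\<Prod>j\<in>UNIV. u j (\<xi> $ j)) * (cmod (P \<xi>))\<^sup>2) \<partial>lborel)"
proof -
  note [measurable] = borel_measurable_poly_space[OF P]
  have mult_exp: "(\<lambda>\<xi>. ennreal ((cmod (mult_exp y P \<xi>))\<^sup>2)) \<in> borel_measurable lebesgue"
    unfolding mult_exp_def by (rule measurable_completion) measurable
  have "(\<integral>\<^sup>+ \<xi>. ennreal ((cmod (mult_exp y P \<xi>))\<^sup>2) \<partial>weight_measure w)
      = (\<integral>\<^sup>+ \<xi>. ennreal (w \<xi>) * ennreal ((cmod (mult_exp y P \<xi>))\<^sup>2) \<partial>lebesgue)"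
    unfolding weight_measure_def
    by (intro nn_integral_density mult_exp measurable_compose[OF w measurable_ennreal])
  also have "\<dots> = (\<integral>\<^sup>+ \<xi>. ennreal (exp ((2 *\<^sub>R y) \<bullet> \<xi>) * (\<Prod>j\<in>UNIV. u j (\<xi> $ j)) * (cmod (P \<xi>))\<^sup>2) \<partial>lebesgue)"
  proof (rule nn_integral_cong_AE[OF eventually_mono[OF AE_completion[OF w_eq]]])
    fix \<xi> assume "w \<xi> = (\<Prod>j\<in>UNIV. u j (\<xi> $ j))"
    moreover have "(cmod (mult_exp y P \<xi>))\<^sup>2 = exp ((2 *\<^sub>R y) \<bullet> \<xi>) * (cmod (P \<xi>))\<^sup>2"
      by (simp add: mult_exp_def norm_mult power_mult_distrib exp_double)
    moreover have "(\<Prod>j\<in>UNIV. u j (\<xi> $ j)) \<ge> 0" by (intro prod_nonneg u_nonneg)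
    ultimately show "ennreal (w \<xi>) * ennreal ((cmod (mult_exp y P \<xi>))\<^sup>2)
        = ennreal (exp ((2 *\<^sub>R y) \<bullet> \<xi>) * (\<Prod>j\<in>UNIV. u j (\<xi> $ j)) * (cmod (P \<xi>))\<^sup>2)"
      by (simp add: mult_ac flip: ennreal_mult)
  qed
  also have "\<dots> = (\<integral>\<^sup>+ \<xi>. ennreal (exp ((2 *\<^sub>R y) \<bullet> \<xi>) * (\<Prod>j\<in>UNIV. u j (\<xi> $ j)) * (cmod (P \<xi>))\<^sup>2) \<partial>lborel)"
    by (intro nn_integral_completion) measurable
  finally show ?thesis .
qed

lemma condition_B_product_weight:
  fixes w :: "real ^ 'd \<Rightarrow> real" and Q :: "'d \<Rightarrow> real \<Rightarrow> real"
  assumes w: "w \<in> borel_measurable lebesgue"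
    and Q_meas: "\<And>i. Q i \<in> borel_measurable (lebesgue_on {0..})"
    and w_prod: "AE \<xi> in lebesgue. w \<xi> = (\<Prod>i\<in>UNIV. exp (- Q i \<bar>\<xi> $ i\<bar>))"
    and Q_mono: "\<And>i. \<exists>c. \<exists>T\<ge>0. mono_on {T..} (\<lambda>t. Q i t + c * t)"
    and Q_growth: "\<And>i. \<exists>R>0. filterlim (\<lambda>t. Q i (t + R) - Q i t) at_top at_top"
  shows "condition_B w"
proof -
  obtain u where u: "\<And>i. u i \<in> borel_measurable borel" "\<And>i t. u i t \<ge> 0"
    and u_eq: "\<And>i. AE t in lborel. u i t = exp (- Q i \<bar>t\<bar>)"
    using borel_version_of_even_weight[OF Q_meas] by metis
  have "AE \<xi> in lborel. \<forall>i. u i (\<xi> $ i) = exp (- Q i \<bar>\<xi> $ i\<bar>)"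
  proof (subst AE_all_countable, intro allI)
    fix i
    have "AE \<xi> :: real ^ 'd in lborel. u i (\<xi> \<bullet> axis i 1) = exp (- Q i \<bar>\<xi> \<bullet> axis i 1\<bar>)"
      using u_eq by (rule AE_lborel_coordinate) (simp add: axis_in_Basis_iff)
    then show "AE \<xi> in lborel. u i (\<xi> $ i) = exp (- Q i \<bar>\<xi> $ i\<bar>)" by (simp add: inner_axis)
  qed
  moreover have "AE \<xi> in lborel. w \<xi> = (\<Prod>i\<in>UNIV. exp (- Q i \<bar>\<xi> $ i\<bar>))"
    using w_prod by (simp add: AE_completion_iff)
  ultimately have w_eq: "AE \<xi> in lborel. w \<xi> = (\<Prod>j\<in>UNIV. u j (\<xi> $ j))"
    by eventually_elim simp
  define M where "M = one_variable_constant ^ CARD('d)"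
  have M: "M \<ge> 1"
  proof -
    have "exp 4 \<ge> (1::real)" "exp 1 \<ge> (1::real)" by simp_all
    then have "17 * (64 * exp 4) * exp 1 \<ge> 17 * (64 * 1) * (1::real)" by (intro mult_mono) auto
    then show ?thesis unfolding M_def one_variable_constant_def by (intro one_le_power) linarith
  qed
  \<comment> \<open>With \<open>z = 0\<close> this is the bound for \<open>E_plus\<close>, and with \<open>y = 0\<close> the one for \<open>E_minus\<close>.\<close>
  have bound: "\<forall>\<^sub>F n in sequentially. ennreal_root n
      (SUP P \<in> poly_space n - {\<lambda>_. 0}. L2_norm w (mult_exp y P) / L2_norm w (mult_exp z P)) \<le> ennreal M"
    for y z :: "real ^ 'd"
    using change_exponent[where Q = Q and u = u and a = "2 *\<^sub>R y" and b = "2 *\<^sub>R z",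
        OF Q_mono Q_growth u u_eq] eventually_gt_at_top[of "0::nat"]
  proof eventually_elim
    case (elim n)
    have "L2_norm w (mult_exp y P) / L2_norm w (mult_exp z P) \<le> ennreal (M ^ n)" if P: "P \<in> poly_space n" for P
    proof (intro ennreal_divide_le L2_norm_le)
      show "M ^ n > 0" using M by simp
      \<comment> \<open>\<open>change_exponent\<close> bounds squared norms; squaring its factor saves a square root in \<open>M\<close>.\<close>
      have "ennreal (M ^ n) \<le> ennreal ((M ^ n)\<^sup>2)"
        using M by (intro ennreal_leI) (simp add: self_le_power)
      then show "(\<integral>\<^sup>+ \<xi>. ennreal ((cmod (mult_exp y P \<xi>))\<^sup>2) \<partial>weight_measure w)
          \<le> ennreal ((M ^ n)\<^sup>2) * (\<integral>\<^sup>+ \<xi>. ennreal ((cmod (mult_exp z P \<xi>))\<^sup>2) \<partial>weight_measure w)"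
        unfolding nn_integral_weight_measure_mult_exp[OF w w_eq u P]
        using elim P unfolding M_def[symmetric] by (meson order_trans mult_right_mono zero_le)
    qed
    then have "(SUP P \<in> poly_space n - {\<lambda>_. 0}. L2_norm w (mult_exp y P) / L2_norm w (mult_exp z P))
        \<le> ennreal (M ^ n) * 1" by (auto intro!: SUP_least)
    then have "ennreal_root n (SUP P \<in> poly_space n - {\<lambda>_. 0}. L2_norm w (mult_exp y P) / L2_norm w (mult_exp z P))
        \<le> ennreal M * ennreal_root n 1" using M elim by (intro ennreal_root_le) auto
    also have "ennreal_root n 1 = 1" using elim by (simp add: ennreal_root_def)
    finally show ?case by simp
  qed
  have mult_exp_0: "mult_exp 0 P = P" for P :: "real ^ 'd \<Rightarrow> complex" by (simp add: mult_exp_def)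
  show ?thesis
    unfolding condition_B_def
  \<comment> \<open>A number above \<open>M\<close> is needed, as the upper limits are only known to be at most \<open>M\<close>.\<close>
  proof (intro exI[of _ "M + 1"] conjI allI)
    show "M + 1 > 0" using M by simp
    fix y :: "real ^ 'd"
    have lt: "ennreal M < ennreal (M + 1)" using M by (simp add: ennreal_less_iff)
    have "limsup (\<lambda>n. E_minus n y w) \<le> ennreal M"
      using bound[of 0 y] by (intro Limsup_bounded) (simp add: E_minus_def mult_exp_0)
    then show "limsup (\<lambda>n. E_minus n y w) < ennreal (M + 1)" using lt by (rule le_less_trans)
    have "limsup (\<lambda>n. E_plus n y w) \<le> ennreal M"
      using bound[of y 0] by (intro Limsup_bounded) (simp add: E_plus_def mult_exp_0)
    then show "limsup (\<lambda>n. E_plus n y w) < ennreal (M + 1)" using lt by (rule le_less_trans)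
  qed
qed

section \<open>Signed permutations and the span of the symmetries\<close>

text \<open>
  The exceptional set of the conclusion is the image of the given one under the inverse matrix,
  and linear maps preserve null sets.
\<close>

lemma AE_lebesgue_invertible_matrix:
  fixes B :: "real ^ 'd ^ 'd"
  assumes inv: "invertible B" and P: "AE \<xi> in lebesgue. P \<xi>"
  shows "AE \<xi> in lebesgue. P (B *v \<xi>)"
proof -
  from inv obtain B' where B': "B' ** B = mat 1" unfolding invertible_def by blast
  from P obtain N where N: "negligible N" "{\<xi>. \<not> P \<xi>} \<subseteq> N"
    by (auto simp: eventually_ae_filter_negligible)
  have "negligible ((*v) B' ` N)"
    using N(1) by (rule negligible_differentiable_image_negligible[OF order_refl])
      (intro linear_imp_differentiable_on matrix_vector_mul_linear)
  moreover have "{\<xi>. \<not> P (B *v \<xi>)} \<subseteq> (*v) B' ` N"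
  proof
    fix \<xi> assume "\<xi> \<in> {\<xi>. \<not> P (B *v \<xi>)}"
    then have "B *v \<xi> \<in> N" using N by blast
    moreover have "\<xi> = B' *v (B *v \<xi>)" by (simp add: matrix_vector_mul_assoc B')
    ultimately show "\<xi> \<in> (*v) B' ` N" by blast
  qed
  ultimately show ?thesis unfolding eventually_ae_filter_negligible by blast
qed

definition signed_permutation_matrix :: "('d \<Rightarrow> 'd) \<Rightarrow> ('d \<Rightarrow> real) \<Rightarrow> real ^ 'd ^ 'd" where
  "signed_permutation_matrix \<sigma> s = (\<chi> i j. if j = \<sigma> i then s i else 0)"

context
  fixes \<sigma> :: "'d::finite \<Rightarrow> 'd" and s :: "'d \<Rightarrow> real"
  assumes \<sigma>: "bij \<sigma>" and s: "\<And>i. \<bar>s i\<bar> = 1"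
begin

lemma invertible_signed_permutation_matrix: "invertible (signed_permutation_matrix \<sigma> s)"
proof -
  have sq: "s i * s i = 1" for i using s[of i] by (metis abs_mult_self_eq mult_1)
  have "signed_permutation_matrix \<sigma> s ** transpose (signed_permutation_matrix \<sigma> s) = mat 1"
    using bij_is_inj[OF \<sigma>]
    by (auto simp: vec_eq_iff matrix_matrix_mult_def transpose_def signed_permutation_matrix_def mat_def
        if_distrib[of "\<lambda>x. x * _"] sq inj_eq cong: if_cong)
  then show ?thesis using matrix_left_right_inverse unfolding invertible_def by blast
qed

text \<open>
  Up to signs, the transposed matrix moves the \<open>i\<close>-th coordinate to position \<open>\<sigma> i\<close>.
\<close>

lemma abs_transpose_signed_permutation_matrix:
  "\<bar>(transpose (signed_permutation_matrix \<sigma> s) *v \<xi>) $ \<sigma> i\<bar> = \<bar>\<xi> $ i\<bar>"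
proof -
  have "(transpose (signed_permutation_matrix \<sigma> s) *v \<xi>) $ \<sigma> i
      = (\<Sum>k\<in>UNIV. (if i = k then s k else 0) * \<xi> $ k)"
    using bij_is_inj[OF \<sigma>]
    by (simp add: matrix_vector_mult_def transpose_def signed_permutation_matrix_def inj_eq)
  also have "\<dots> = s i * \<xi> $ i" by (simp add: if_distrib[of "\<lambda>x. x * _"] cong: if_cong)
  finally show ?thesis by (simp add: abs_mult s)
qed

end

text \<open>
  The weight at the transformed point is the product of the \<open>e\<^bsup>-Q\<^esup>\<close> with \<open>Q\<^bsub>\<sigma> i\<^esub>\<close> in place of
  \<open>Q\<^sub>i\<close>, so that \<open>\<lambda>\<close> can be read off from the bounds on \<open>\<bar>Q\<^bsub>\<sigma> i\<^esub> - Q\<^sub>i\<bar>\<close>.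
\<close>

lemma signed_permutation_matrix_in_weight_matrices:
  fixes w :: "real ^ 'd \<Rightarrow> real" and Q :: "'d \<Rightarrow> real \<Rightarrow> real"
  assumes w_prod: "AE \<xi> in lebesgue. w \<xi> = (\<Prod>i\<in>UNIV. exp (- Q i \<bar>\<xi> $ i\<bar>))"
    and Q_diff: "\<And>i j. \<exists>M. \<forall>t\<ge>0. \<bar>Q i t - Q j t\<bar> \<le> M"
    and \<sigma>: "bij \<sigma>" and s: "\<And>i. \<bar>s i\<bar> = 1"
  shows "signed_permutation_matrix \<sigma> s \<in> weight_matrices w"
proof -
  let ?A = "signed_permutation_matrix \<sigma> s"
  from Q_diff obtain M where M: "\<And>i j t. t \<ge> 0 \<Longrightarrow> \<bar>Q i t - Q j t\<bar> \<le> M i j" by metis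
  define l where "l = (\<Prod>i\<in>UNIV. exp (- M (\<sigma> i) i))"
  have inv: "invertible ?A" using \<sigma> s by (rule invertible_signed_permutation_matrix)
  have "AE \<xi> in lebesgue. w (transpose ?A *v \<xi>) = (\<Prod>i\<in>UNIV. exp (- Q i \<bar>(transpose ?A *v \<xi>) $ i\<bar>))"
    using inv w_prod by (intro AE_lebesgue_invertible_matrix) (auto simp: transpose_invertible)
  with w_prod have "AE \<xi> in lebesgue. w (transpose ?A *v \<xi>) \<ge> l * w \<xi>"
  proof eventually_elim
    case (elim \<xi>)
    have "l * w \<xi> = (\<Prod>i\<in>UNIV. exp (- M (\<sigma> i) i) * exp (- Q i \<bar>\<xi> $ i\<bar>))"
      by (simp add: l_def elim(1) prod.distrib)
    also have "\<dots> \<le> (\<Prod>i\<in>UNIV. exp (- Q (\<sigma> i) \<bar>\<xi> $ i\<bar>))"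
    proof (intro prod_mono conjI)
      fix i
      show "exp (- M (\<sigma> i) i) * exp (- Q i \<bar>\<xi> $ i\<bar>) \<le> exp (- Q (\<sigma> i) \<bar>\<xi> $ i\<bar>)"
        using M[of "\<bar>\<xi> $ i\<bar>" "\<sigma> i" i] by (simp flip: exp_add)
    qed simp
    also have "\<dots> = (\<Prod>i\<in>UNIV. exp (- Q (\<sigma> i) \<bar>(transpose ?A *v \<xi>) $ \<sigma> i\<bar>))"
      using abs_transpose_signed_permutation_matrix[of \<sigma> s] \<sigma> s by simp
    also have "\<dots> = w (transpose ?A *v \<xi>)"
      unfolding elim(2) by (rule prod.reindex_bij_betw[OF \<sigma>])
    finally show ?case .
  qed
  moreover have "l > 0" by (auto simp: l_def intro!: prod_pos)
  ultimately show ?thesis unfolding weight_matrices_def using inv by blast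
qed

lemma condition_C_product_weight:
  fixes w :: "real ^ 'd \<Rightarrow> real" and Q :: "'d \<Rightarrow> real \<Rightarrow> real"
  assumes w_prod: "AE \<xi> in lebesgue. w \<xi> = (\<Prod>i\<in>UNIV. exp (- Q i \<bar>\<xi> $ i\<bar>))"
    and Q_diff: "\<And>i j. \<exists>M. \<forall>t\<ge>0. \<bar>Q i t - Q j t\<bar> \<le> M"
  shows "condition_C w"
proof -
  have "axis i (axis j 1) \<in> span (weight_matrices w)" for i j
  proof -
    let ?\<sigma> = "Transposition.transpose i j"
    let ?A = "\<lambda>s. signed_permutation_matrix ?\<sigma> s"
    have in_G: "?A s \<in> weight_matrices w" if "\<And>i. \<bar>s i\<bar> = 1" for s
      using signed_permutation_matrix_in_weight_matrices[OF w_prod Q_diff] that by simp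
    \<comment> \<open>A row of a signed permutation matrix has one nonzero entry; flipping the sign of row \<open>i\<close> isolates it.\<close>
    have "axis i (axis j 1) = (1 / 2) *\<^sub>R (?A (\<lambda>_. 1) - ?A (\<lambda>k. if k = i then - 1 else 1))"
      by (auto simp: vec_eq_iff signed_permutation_matrix_def axis_def)
    also have "\<dots> \<in> span (weight_matrices w)"
      by (intro span_scale span_diff span_base in_G) auto
    finally show ?thesis .
  qed
  then have "Basis \<subseteq> span (weight_matrices w)"
    by (auto simp: Basis_vec_def)
  then have "span Basis \<subseteq> span (weight_matrices w)" by (metis span_mono span_span)
  then show ?thesis unfolding condition_C_def by (simp add: top.extremum_unique)
qed

section \<open>The product weight\<close>

theorem corollary10:
  fixes w :: "real ^ 'd \<Rightarrow> real"
    and Q :: "'d \<Rightarrow> real \<Rightarrow> real"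
  assumes w_L1: "integrable lebesgue w"
    and w_Linfty: "\<exists>M. AE \<xi> in lebesgue. \<bar>w \<xi>\<bar> \<le> M"
    and w_nonzero: "\<not> (AE \<xi> in lebesgue. w \<xi> = 0)"
    and w_A: "condition_A w"
    and Q_meas: "\<And>i. Q i \<in> borel_measurable (lebesgue_on {0..})"
    and w_prod: "AE \<xi> in lebesgue. w \<xi> = (\<Prod>i\<in>UNIV. exp (- Q i \<bar>\<xi> $ i\<bar>))"
    and Q_diff: "\<And>i j. \<exists>M. \<forall>t\<ge>0. \<bar>Q i t - Q j t\<bar> \<le> M"
    and Q_mono: "\<And>i. \<exists>c. \<exists>T\<ge>0. mono_on {T..} (\<lambda>t. Q i t + c * t)"
    and Q_growth: "\<And>i. \<exists>R>0. filterlim (\<lambda>t. Q i (t + R) - Q i t) at_top at_top"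
  shows "condition_A w \<and> condition_B w \<and> condition_C w"
proof (intro conjI)
  show "condition_A w" by (rule w_A)
  have "w \<in> borel_measurable lebesgue" using w_L1 by (rule borel_measurable_integrable)
  then show "condition_B w" using Q_meas w_prod Q_mono Q_growth by (rule condition_B_product_weight)
  show "condition_C w" using w_prod Q_diff by (rule condition_C_product_weight)
qed

end
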